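(* Let $p,c>1$ and let $$\overline{T}_{c,p}(X)=\inf_{s\in\mathbb{R}}\{c\,\|(s-X)^+\|_p-s\},\qquad X\in L^1.$$ Let $q$ be such that $\frac1q+\frac1p=1$, and let $$\mathcal{M}_q=\Big\{\mu\in\mathcal{P}((0,1]):\int_0^1\Big|\int_\alpha^1\frac{\mu(\mathrm{d}t)}{t}\Big|^q\mathrm{d}\alpha\le c^q\Big\}.$$ Then for any $X\in L^1$, $$\overline{T}_{c,p}(X)=\sup_{\mu\in\mathcal{M}_q}\int_0^1\mathrm{AVaR}_\alpha(X)\,\mu(\mathrm{d}\alpha).$$
   Context: $(\Omega,\mathcal{F},\mathbb{P})$ is a fixed nonatomic probability space; $L^1$ is the space of integrable random variables modulo a.s. equality. $\|\cdot\|_p$ is the $L^p$-norm, with $\|Z\|_p=\infty$ if $Z\notin L^p$; $x^+=\max\{x,0\}$. $\mathcal{P}((0,1])$ is the set of Borel probability measures on $(0,1]$. For $X\in L^1$ and $\alpha\in(0,1]$, $\mathrm{AVaR}_\alpha(X)=\frac1\alpha\int_0^\alpha\mathrm{VaR}_t(X)\,\mathrm{d}t$, where $\mathrm{VaR}_t(X)=\inf\{m\in\mathbb{R}:\mathbb{P}(X+m<0)\le t\}$. Both sides of the identity may equal $+\infty$. *)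

theory Defs
  imports "HOL-Probability.Probability"
begin

definition nonatomic :: "'a measure \<Rightarrow> bool" where
  "nonatomic M \<longleftrightarrow>
     (\<forall>A\<in>sets M. emeasure M A > 0 \<longrightarrow>
        (\<exists>B\<in>sets M. B \<subseteq> A \<and> 0 < emeasure M B \<and> emeasure M B < emeasure M A))"

definition lp_norm :: "'a measure \<Rightarrow> real \<Rightarrow> ('a \<Rightarrow> real) \<Rightarrow> ereal" where
  "lp_norm M p Z =
     (if Z \<in> borel_measurable M \<and> integrable M (\<lambda>\<omega>. \<bar>Z \<omega>\<bar> powr p)
      then ereal ((\<integral>\<omega>. \<bar>Z \<omega>\<bar> powr p \<partial>M) powr (1 / p))
      else \<infinity>)"

(* Integral with values in the extended reals, for f whose negative part has finite integral
   (in ereal, \<infinity> - \<infinity> is \<infinity>).  Note that ennreal truncates negative reals to 0. *)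
definition ext_integral :: "'a measure \<Rightarrow> ('a \<Rightarrow> real) \<Rightarrow> ereal" where
  "ext_integral M f =
     enn2ereal (\<integral>\<^sup>+\<omega>. ennreal (f \<omega>) \<partial>M) - enn2ereal (\<integral>\<^sup>+\<omega>. ennreal (- f \<omega>) \<partial>M)"

(* For 0 < t < 1 the set below is nonempty and bounded below, so the real infimum is the true one;
   only these t are used. *)
definition VaR :: "'a measure \<Rightarrow> real \<Rightarrow> ('a \<Rightarrow> real) \<Rightarrow> real" where
  "VaR M t X = Inf {m. measure M {\<omega>\<in>space M. X \<omega> + m < 0} \<le> t}"

(* The open interval avoids the null set of endpoints, where the value at risk may be infinite.
   For integrable X the function t \<mapsto> VaR M t X is integrable on (0,1), so this is a real number. *)
definition AVaR :: "'a measure \<Rightarrow> real \<Rightarrow> ('a \<Rightarrow> real) \<Rightarrow> real" where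
  "AVaR M \<alpha> X = (1 / \<alpha>) * (LBINT t:{0<..<\<alpha>}. VaR M t X)"

definition T_bar :: "'a measure \<Rightarrow> real \<Rightarrow> real \<Rightarrow> ('a \<Rightarrow> real) \<Rightarrow> ereal" where
  "T_bar M c p X = (INF s::real. ereal c * lp_norm M p (\<lambda>\<omega>. max (s - X \<omega>) 0) - ereal s)"

(* Borel probability measures on (0,1].  For \<alpha> > 0 the integrand 1 / t is bounded on (\<alpha>,1],
   so the inner integral is finite; reading it over [\<alpha>,1] instead changes it for at most
   countably many \<alpha>. *)
definition M_set :: "real \<Rightarrow> real \<Rightarrow> real measure set" where
  "M_set c q =
     {\<mu> \<in> space (prob_algebra (restrict_space borel {0<..1})).
        (\<integral>\<^sup>+\<alpha>\<in>{0<..<1}. ennreal (\<bar>LINT t:{\<alpha><..1}|\<mu>. 1 / t\<bar> powr q) \<partial>lborel)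
          \<le> ennreal (c powr q)}"

end

theory Submission
  imports Defs
begin

text \<open>Since \<open>t \<mapsto> VaR M t X\<close> on \<open>(0,1)\<close> with Lebesgue measure has the law of \<open>-X\<close>, both sides depend
  only on the nonincreasing function \<open>V t = VaR M t X\<close>. By Tonelli, \<open>\<integral> AVaR d\<mu> = \<integral> V g dt\<close> with
  \<open>g t = \<integral>\<^bsub>(t,1]\<^esub> \<mu>(d\<alpha>)/\<alpha>\<close>, and \<open>\<mu> \<mapsto> g\<close> maps the probability measures on \<open>(0,1]\<close> onto the nonincreasing
  densities on \<open>(0,1)\<close> (up to null sets). The bound \<open>\<ge>\<close> is Hoelder's inequality applied to
  \<open>\<integral> (s + V) g - s\<close>. Conversely, put \<open>Z = (s + V)\<^sup>+\<close> and \<open>g\<close> proportional to \<open>Z\<^sup>p\<^sup>-\<^sup>1\<close>: this density is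
  admissible when \<open>c \<integral> Z\<^sup>p\<^sup>-\<^sup>1 \<ge> (\<integral> Z\<^sup>p)\<^sup>1\<^sup>/\<^sup>q\<close>, which holds for large \<open>s\<close>, and then yields at least \<open>-s\<close>; in the case of
  equality it yields exactly \<open>c \<parallel>Z\<parallel>\<^sub>p - s\<close>. Lower \<open>s\<close> from such a large value: either equality occurs at some \<open>s\<close>
  with \<open>Z \<noteq> 0\<close>, by the intermediate value theorem, or every \<open>-s\<close> with \<open>Z \<noteq> 0\<close> is a lower bound of the
  supremum, and \<open>c \<parallel>Z\<parallel>\<^sub>p - s = -s\<close> once \<open>Z = 0\<close>.\<close>

section \<open>Value at risk as a quantile function\<close>

text \<open>The endpoints are left out because quantiles may be infinite there.\<close>

definition unif :: "real measure" where
  "unif = restrict_space lborel {0<..<1}"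

lemma space_unif [simp]: "space unif = {0<..<1}"
  by (simp add: unif_def space_restrict_space)

lemma sets_unif [measurable_cong]: "sets unif = sets (restrict_space borel {0<..<1})"
  unfolding unif_def by (rule sets_restrict_space_cong) simp

lemma prob_space_unif: "prob_space unif"
  by (auto simp: unif_def emeasure_restrict_space space_restrict_space intro!: prob_spaceI)

interpretation unif: prob_space unif
  by (rule prob_space_unif)

lemma measure_unif [simp]: "measure unif {0<..<1} = 1"
  using unif.prob_space by simp

lemma nn_integral_unif: "(\<integral>\<^sup>+t. f t \<partial>unif) = (\<integral>\<^sup>+t\<in>{0<..<1}. f t \<partial>lborel)"
  unfolding unif_def by (rule nn_integral_restrict_space) simp

lemma borel_measurable_unif_antimono:
  fixes f :: "real \<Rightarrow> real"
  assumes "antimono_on {0<..<1} f"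
  shows "f \<in> borel_measurable unif"
proof -
  have "mono_on {0<..<1} (\<lambda>x. - f x)"
    using assms by (auto simp: monotone_on_def)
  then have "(\<lambda>x. - f x) \<in> borel_measurable (restrict_space borel {0<..<1})"
    by (rule borel_measurable_mono_on_fnc)
  then have "(\<lambda>x. - (- f x)) \<in> borel_measurable (restrict_space borel {0<..<1})"
    by (rule borel_measurable_uminus)
  then show ?thesis
    by (simp cong: measurable_cong_sets add: measurable_cong_sets[OF sets_unif refl])
qed

text \<open>Needed because quantiles increase with their level, whereas the value at risk at
  \<open>t\<close> is a quantile at level \<open>1 - t\<close>.\<close>

lemma distr_unif_reflect: "distr unif unif (\<lambda>t. 1 - t) = unif"
proof (rule measure_eqI)
  fix A assume "A \<in> sets (distr unif unif (\<lambda>t. 1 - t))"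
  then have A: "A \<in> sets unif" by simp
  have m: "(\<lambda>t::real. 1 - t) \<in> unif \<rightarrow>\<^sub>M unif"
    by (simp add: measurable_cong_sets[OF sets_unif sets_unif] measurable_restrict_space1 measurable_restrict_space2_iff)
  have A': "A \<in> sets borel" "A \<subseteq> {0<..<1}"
    using A by (auto simp: sets_unif sets_restrict_space)
  have "emeasure (distr unif unif (\<lambda>t. 1 - t)) A = emeasure unif ((\<lambda>t. 1 - t) -` A \<inter> {0<..<1})"
    using A m by (simp add: emeasure_distr)
  also have "(\<lambda>t::real. 1 - t) -` A \<inter> {0<..<1} = (\<lambda>t. 1 - t) -` A"
    using A'(2) by auto
  also have "emeasure unif ((\<lambda>t. 1 - t) -` A) = emeasure lborel ((\<lambda>t. 1 - t) -` A)"
    using A'(2) unfolding unif_def by (subst emeasure_restrict_space) auto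
  also have "\<dots> = emeasure (distr lborel borel (\<lambda>t::real. 1 + (-1) * t)) A"
    using A' by (subst emeasure_distr) auto
  \<comment> \<open>The trivial density, written as the absolute value of the slope -1, gives the
    shape of the change of variables formula for affine maps.\<close>
  also have "\<dots> = emeasure (density (distr lborel borel (\<lambda>t::real. 1 + (-1) * t)) (\<lambda>_. ennreal \<bar>-1\<bar>)) A"
    by (simp add: density_1)
  also have "density (distr lborel borel (\<lambda>t::real. 1 + (-1) * t)) (\<lambda>_. ennreal \<bar>-1\<bar>) = lborel"
    by (subst (2) lborel_real_affine[of "-1" 1]) (auto simp: one_ennreal_def)
  also have "emeasure lborel A = emeasure unif A"
    using A' unfolding unif_def by (subst emeasure_restrict_space) auto
  finally show "emeasure (distr unif unif (\<lambda>t. 1 - t)) A = emeasure unif A" .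
qed simp

text \<open>With \<open>F\<close> the distribution function of \<open>-X\<close>, the set defining
  \<open>VaR M t X\<close> is the set of \<open>m\<close> with \<open>1 - t \<le> F m\<close>. Its
  infimum is the generalised inverse \<open>N.I\<close> at \<open>1 - t\<close>, and a generalised
  inverse applied to a uniform variable has the given law.\<close>

lemma
  assumes "prob_space M" and X[measurable]: "X \<in> borel_measurable M"
  shows antimono_VaR: "antimono_on {0<..<1} (\<lambda>t. VaR M t X)"
    and distr_VaR: "distr unif borel (\<lambda>t. VaR M t X) = distr M borel (\<lambda>\<omega>. - X \<omega>)"
proof -
  interpret prob_space M by fact
  define N where "N = distr M borel (\<lambda>\<omega>. - X \<omega>)"
  interpret N: cdf_distribution N
    unfolding cdf_distribution_def real_distribution_def real_distribution_axioms_def N_def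
    by (auto intro!: prob_space_distr)
  have cdf: "cdf N m = 1 - measure M {\<omega>\<in>space M. X \<omega> + m < 0}" for m
  proof -
    have "cdf N m = measure M {\<omega>\<in>space M. - X \<omega> \<le> m}"
      unfolding cdf_def N_def
      by (subst measure_distr) (auto intro!: arg_cong2[where f=measure])
    also have "{\<omega>\<in>space M. - X \<omega> \<le> m} = space M - {\<omega>\<in>space M. X \<omega> + m < 0}"
      by auto
    also have "measure M \<dots> = 1 - measure M {\<omega>\<in>space M. X \<omega> + m < 0}"
      by (rule prob_compl) measurable
    finally show ?thesis .
  qed
  have VaR: "VaR M t X = N.I (1 - t)" for t
    unfolding VaR_def cdf by (intro arg_cong[where f=Inf]) auto
  show "antimono_on {0<..<1} (\<lambda>t. VaR M t X)"
    using N.mono_I unfolding VaR monotone_on_def by auto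
  have [measurable]: "N.I \<in> borel_measurable unif"
    using N.measurable_CI by (simp add: measurable_cong_sets[OF sets_unif refl])
  have m[measurable]: "(\<lambda>t::real. 1 - t) \<in> unif \<rightarrow>\<^sub>M unif"
    by (simp add: measurable_cong_sets[OF sets_unif sets_unif] measurable_restrict_space1 measurable_restrict_space2_iff)
  have "distr unif borel (\<lambda>t. VaR M t X) = distr (distr unif unif (\<lambda>t. 1 - t)) borel N.I"
    unfolding VaR by (subst distr_distr) (auto simp: o_def)
  also have "\<dots> = N"
    unfolding distr_unif_reflect using N.distr_I_eq_M by (simp add: unif_def)
  finally show "distr unif borel (\<lambda>t. VaR M t X) = distr M borel (\<lambda>\<omega>. - X \<omega>)"
    by (simp add: N_def)
qed

text \<open>Expectations of functions of \<open>-X\<close> depend only on its law, which the value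
  at risk shares. This moves the whole problem to the unit interval and a nonincreasing function
  there.\<close>

lemma
  assumes "prob_space M" and X[measurable]: "integrable M X"
  shows integrable_VaR: "integrable unif (\<lambda>t. VaR M t X)"
    and T_bar_VaR: "T_bar unif c p (\<lambda>t. - VaR M t X) = T_bar M c p X"
proof -
  let ?V = "\<lambda>t. VaR M t X"
  have [measurable]: "?V \<in> borel_measurable unif"
    by (rule borel_measurable_unif_antimono[OF antimono_VaR]) (use assms in auto)
  have d: "distr unif borel ?V = distr M borel (\<lambda>\<omega>. - X \<omega>)"
    by (rule distr_VaR) (use assms in auto)
  have int: "integrable unif (\<lambda>t. h (?V t)) = integrable M (\<lambda>\<omega>. h (- X \<omega>))"
    if [measurable]: "h \<in> borel_measurable borel" for h :: "real \<Rightarrow> real"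
    using integrable_distr_eq[of ?V unif borel h] integrable_distr_eq[of "\<lambda>\<omega>. - X \<omega>" M borel h]
    by (simp add: d)
  have lint: "(\<integral>t. h (?V t) \<partial>unif) = (\<integral>\<omega>. h (- X \<omega>) \<partial>M)"
    if [measurable]: "h \<in> borel_measurable borel" for h :: "real \<Rightarrow> real"
    using integral_distr[of ?V unif borel h] integral_distr[of "\<lambda>\<omega>. - X \<omega>" M borel h]
    by (simp add: d)
  show "integrable unif ?V"
    using int[of "\<lambda>x. x"] assms by simp
  have "lp_norm unif p (\<lambda>t. max (s - - ?V t) 0) = lp_norm M p (\<lambda>\<omega>. max (s - X \<omega>) 0)" for s
    using int[of "\<lambda>x. \<bar>max (s + x) 0\<bar> powr p"] lint[of "\<lambda>x. \<bar>max (s + x) 0\<bar> powr p"]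
    by (simp add: lp_norm_def)
  then show "T_bar unif c p (\<lambda>t. - VaR M t X) = T_bar M c p X"
    by (simp add: T_bar_def)
qed

section \<open>The spectrum of a mixture of averages\<close>

text \<open>The weight that the \<mu>-mixture of averages over \<open>(0, \<alpha>)\<close> places
  on the level \<open>t\<close>. It is extended-valued because it may be infinite at
  \<open>t = 0\<close>.\<close>

definition risk_spectrum :: "real measure \<Rightarrow> real \<Rightarrow> ennreal" where
  "risk_spectrum \<mu> t = (\<integral>\<^sup>+\<alpha>. ennreal (1 / \<alpha>) * indicator {t<..} \<alpha> \<partial>\<mu>)"

abbreviation prob_measures :: "real measure set" where
  "prob_measures \<equiv> space (prob_algebra (restrict_space borel {0<..1}))"

lemma prob_measuresD:
  assumes "\<mu> \<in> prob_measures"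
  shows "prob_space \<mu>" "sets \<mu> = sets (restrict_space borel {0<..1})" "space \<mu> = {0<..1}"
  using assms sets_eq_imp_space_eq[of \<mu> "restrict_space borel {0<..1}"]
  by (auto simp: space_prob_algebra space_restrict_space)

lemma borel_measurable_risk_spectrum:
  assumes "\<mu> \<in> prob_measures"
  shows "risk_spectrum \<mu> \<in> borel_measurable borel"
proof -
  note [measurable_cong] = prob_measuresD(2)[OF assms]
  interpret prob_space \<mu> by (rule prob_measuresD(1)[OF assms])
  have [measurable]: "(\<lambda>x. x) \<in> borel_measurable \<mu>"
    by (simp add: measurable_cong_sets[OF prob_measuresD(2)[OF assms] refl] measurable_restrict_space1)
  \<comment> \<open>The conditional makes joint measurability in \<open>t\<close> and \<alpha>
    visible, unlike the indicator of a set depending on \<open>t\<close>.\<close>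
  have *: "risk_spectrum \<mu> = (\<lambda>t. \<integral>\<^sup>+\<alpha>. ennreal (1 / \<alpha>) * (if t < \<alpha> then 1 else 0) \<partial>\<mu>)"
    by (auto simp: risk_spectrum_def fun_eq_iff intro!: nn_integral_cong)
  show ?thesis
    unfolding * by measurable
qed

lemma borel_imp_unif: "f \<in> borel_measurable borel \<Longrightarrow> f \<in> borel_measurable unif"
  by (simp add: measurable_cong_sets[OF sets_unif refl] measurable_restrict_space1)

lemma measurable_ident_unif [measurable]: "(\<lambda>t. t) \<in> borel_measurable unif"
  by (rule borel_imp_unif) simp

text \<open>Tonelli on the region \<open>t < \<alpha>\<close>: integrating over \<open>t\<close>
  first gives averages, over \<alpha> first gives the spectrum.\<close>

lemma
  assumes \<mu>: "\<mu> \<in> prob_measures" and h[measurable]: "h \<in> borel_measurable unif"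
  shows borel_measurable_average:
      "(\<lambda>\<alpha>. ennreal (1 / \<alpha>) * (\<integral>\<^sup>+t. h t * indicator {..<\<alpha>} t \<partial>unif)) \<in> borel_measurable \<mu>"
    and nn_integral_average:
      "(\<integral>\<^sup>+\<alpha>. ennreal (1 / \<alpha>) * (\<integral>\<^sup>+t. h t * indicator {..<\<alpha>} t \<partial>unif) \<partial>\<mu>) =
        (\<integral>\<^sup>+t. h t * risk_spectrum \<mu> t \<partial>unif)"
proof -
  interpret prob_space \<mu> by (rule prob_measuresD(1)[OF \<mu>])
  interpret pair_sigma_finite \<mu> unif ..
  have [measurable]: "(\<lambda>x. x) \<in> borel_measurable \<mu>"
    by (simp add: measurable_cong_sets[OF prob_measuresD(2)[OF \<mu>] refl] measurable_restrict_space1)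
  have *: "(\<integral>\<^sup>+t. h t * indicator {..<\<alpha>} t \<partial>unif) = (\<integral>\<^sup>+t. h t * (if t < \<alpha> then 1 else 0) \<partial>unif)" for \<alpha>
    by (auto intro!: nn_integral_cong)
  show "(\<lambda>\<alpha>. ennreal (1 / \<alpha>) * (\<integral>\<^sup>+t. h t * indicator {..<\<alpha>} t \<partial>unif)) \<in> borel_measurable \<mu>"
    unfolding * by measurable
  have "(\<integral>\<^sup>+\<alpha>. ennreal (1 / \<alpha>) * (\<integral>\<^sup>+t. h t * indicator {..<\<alpha>} t \<partial>unif) \<partial>\<mu>) =
      (\<integral>\<^sup>+\<alpha>. (\<integral>\<^sup>+t. h t * (ennreal (1 / \<alpha>) * (if t < \<alpha> then 1 else 0)) \<partial>unif) \<partial>\<mu>)"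
    unfolding * by (subst nn_integral_cmult[symmetric]) (auto intro!: nn_integral_cong simp: ac_simps)
  also have "\<dots> = (\<integral>\<^sup>+t. (\<integral>\<^sup>+\<alpha>. h t * (ennreal (1 / \<alpha>) * (if t < \<alpha> then 1 else 0)) \<partial>\<mu>) \<partial>unif)"
    by (rule Fubini'[symmetric]) measurable
  also have "\<dots> = (\<integral>\<^sup>+t. h t * risk_spectrum \<mu> t \<partial>unif)"
    unfolding risk_spectrum_def
    by (subst nn_integral_cmult) (auto intro!: nn_integral_cong arg_cong[where f="\<lambda>x. h _ * x"])
  finally show "(\<integral>\<^sup>+\<alpha>. ennreal (1 / \<alpha>) * (\<integral>\<^sup>+t. h t * indicator {..<\<alpha>} t \<partial>unif) \<partial>\<mu>) =
        (\<integral>\<^sup>+t. h t * risk_spectrum \<mu> t \<partial>unif)" .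
qed

lemma emeasure_unif_lessThan:
  assumes "0 < \<alpha>" "\<alpha> \<le> 1"
  shows "(\<integral>\<^sup>+t. indicator {..<\<alpha>} t \<partial>unif) = ennreal \<alpha>"
proof -
  have "(\<integral>\<^sup>+t. indicator {..<\<alpha>} t \<partial>unif) = (\<integral>\<^sup>+t. indicator {0<..<\<alpha>} t \<partial>lborel)"
    unfolding nn_integral_unif by (rule nn_integral_cong) (use assms in \<open>auto split: split_indicator\<close>)
  then show ?thesis using assms by simp
qed

text \<open>Every average of the constant 1 is 1, so the spectrum inherits the total mass of
  \<mu>.\<close>

lemma nn_integral_risk_spectrum:
  assumes "\<mu> \<in> prob_measures"
  shows "(\<integral>\<^sup>+t. risk_spectrum \<mu> t \<partial>unif) = 1"
proof -
  interpret prob_space \<mu> by (rule prob_measuresD(1)[OF assms])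
  have "(\<integral>\<^sup>+t. risk_spectrum \<mu> t \<partial>unif) =
      (\<integral>\<^sup>+\<alpha>. ennreal (1 / \<alpha>) * (\<integral>\<^sup>+t. indicator {..<\<alpha>} t \<partial>unif) \<partial>\<mu>)"
    using nn_integral_average[OF assms, of "\<lambda>_. 1"] by simp
  also have "\<dots> = (\<integral>\<^sup>+\<alpha>. 1 \<partial>\<mu>)"
    by (rule nn_integral_cong)
      (auto simp: prob_measuresD(3)[OF assms] emeasure_unif_lessThan ennreal_mult[symmetric] simp flip: ennreal_1)
  finally show ?thesis by (simp add: emeasure_space_1)
qed

text \<open>The value \<open>w \<alpha>\<close> separates the average to the left of \<alpha> from
  the average to its right. Applied to the negative part of \<open>V\<close>, this bounds all its
  averages by one finite number.\<close>

lemma average_mono_le: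
  assumes w: "mono_on {0<..<1} w" and [measurable]: "w \<in> borel_measurable unif"
    and \<alpha>: "0 < \<alpha>" "\<alpha> \<le> 1"
  shows "(\<integral>\<^sup>+t. w t * indicator {..<\<alpha>} t \<partial>unif) \<le> ennreal \<alpha> * (\<integral>\<^sup>+t. w t \<partial>unif)"
proof (cases "\<alpha> = 1")
  case True
  then show ?thesis by (auto intro!: nn_integral_mono split: split_indicator)
next
  case False
  with \<alpha> have \<alpha>1: "\<alpha> < 1" by simp
  let ?I = "\<integral>\<^sup>+t. w t * indicator {..<\<alpha>} t \<partial>unif"
  let ?J = "\<integral>\<^sup>+t. w t * indicator {\<alpha>..} t \<partial>unif"
  have IJ: "(\<integral>\<^sup>+t. w t \<partial>unif) = ?I + ?J"
    by (subst nn_integral_add[symmetric]) (auto intro!: nn_integral_cong split: split_indicator)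
  have "?I \<le> (\<integral>\<^sup>+t. w \<alpha> * indicator {..<\<alpha>} t \<partial>unif)"
    using \<alpha> \<alpha>1 w by (auto intro!: nn_integral_mono split: split_indicator simp: monotone_on_def)
  also have "\<dots> = w \<alpha> * ennreal \<alpha>"
    by (subst nn_integral_cmult) (auto simp: emeasure_unif_lessThan[OF \<alpha>])
  finally have I: "?I \<le> w \<alpha> * ennreal \<alpha>" .
  have "(\<integral>\<^sup>+t. indicator {\<alpha>..} t \<partial>unif) = (\<integral>\<^sup>+t. indicator {\<alpha>..<1} t \<partial>lborel)"
    unfolding nn_integral_unif by (rule nn_integral_cong) (use \<alpha> in \<open>auto split: split_indicator\<close>)
  then have m: "(\<integral>\<^sup>+t. indicator {\<alpha>..} t \<partial>unif) = ennreal (1 - \<alpha>)"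
    using \<alpha> by simp
  have "w \<alpha> * ennreal (1 - \<alpha>) = (\<integral>\<^sup>+t. w \<alpha> * indicator {\<alpha>..} t \<partial>unif)"
    by (subst nn_integral_cmult) (auto simp: m)
  also have "\<dots> \<le> ?J"
    using \<alpha> \<alpha>1 w by (auto intro!: nn_integral_mono split: split_indicator simp: monotone_on_def)
  finally have J: "w \<alpha> * ennreal (1 - \<alpha>) \<le> ?J" .
  \<comment> \<open>Cross-multiplying with the two lengths compares the averages without division in
    \<open>ennreal\<close>.\<close>
  have "?I = ennreal \<alpha> * ?I + ennreal (1 - \<alpha>) * ?I"
    using \<alpha> by (simp flip: distrib_right ennreal_plus)
  also have "ennreal (1 - \<alpha>) * ?I \<le> ennreal (1 - \<alpha>) * (w \<alpha> * ennreal \<alpha>)"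
    by (rule mult_left_mono[OF I]) simp
  also have "\<dots> = ennreal \<alpha> * (w \<alpha> * ennreal (1 - \<alpha>))"
    by (simp add: ac_simps)
  also have "\<dots> \<le> ennreal \<alpha> * ?J"
    by (rule mult_left_mono[OF J]) simp
  finally show ?thesis
    by (simp add: IJ distrib_left)
qed

text \<open>The positive part of an average is in general not the average of the positive part, so
  other decompositions \<open>u - v\<close> must be allowed. Integrating the sum of \<open>v\<close>
  and the positive part of \<open>f\<close>, which equals the sum of \<open>u\<close> and the
  negative part, and moving the two finite integrals across gives the claim.\<close>

lemma ext_integral_eq_diff:
  assumes [measurable]: "u \<in> borel_measurable M" "v \<in> borel_measurable M"
    and f: "\<And>x. x \<in> space M \<Longrightarrow> f x = u x - v x"
    and nn: "\<And>x. x \<in> space M \<Longrightarrow> 0 \<le> u x" "\<And>x. x \<in> space M \<Longrightarrow> 0 \<le> v x"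
    and fin: "(\<integral>\<^sup>+x. ennreal (v x) \<partial>M) < \<top>"
  shows "ext_integral M f = enn2ereal (\<integral>\<^sup>+x. ennreal (u x) \<partial>M) - enn2ereal (\<integral>\<^sup>+x. ennreal (v x) \<partial>M)"
proof -
  have [measurable]: "f \<in> borel_measurable M"
    by (subst measurable_cong[where g="\<lambda>x. u x - v x"]) (auto simp: f)
  let ?F = "\<integral>\<^sup>+x. ennreal (f x) \<partial>M" and ?G = "\<integral>\<^sup>+x. ennreal (- f x) \<partial>M"
  let ?U = "\<integral>\<^sup>+x. ennreal (u x) \<partial>M" and ?V = "\<integral>\<^sup>+x. ennreal (v x) \<partial>M"
  have "?G \<le> ?V"
    using f nn by (intro nn_integral_mono ennreal_leI) auto
  with fin have G: "?G < \<top>" by (rule le_less_trans[rotated])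
  have "?F + ?V = (\<integral>\<^sup>+x. ennreal (f x) + ennreal (v x) \<partial>M)"
    by (rule nn_integral_add[symmetric]) auto
  also have "\<dots> = (\<integral>\<^sup>+x. ennreal (u x) + ennreal (- f x) \<partial>M)"
  proof (rule nn_integral_cong)
    fix x assume x: "x \<in> space M"
    show "ennreal (f x) + ennreal (v x) = ennreal (u x) + ennreal (- f x)"
      using nn[OF x] unfolding f[OF x]
      by (cases "v x \<le> u x") (auto simp: ennreal_neg simp flip: ennreal_plus)
  qed
  also have "\<dots> = ?U + ?G"
    by (rule nn_integral_add) auto
  finally have *: "?F + ?V = ?U + ?G" .
  obtain v' where v': "?V = ennreal v'" "0 \<le> v'"
    using fin by (cases ?V) auto
  obtain g' where g': "?G = ennreal g'" "0 \<le> g'"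
    using G by (cases ?G) auto
  show ?thesis
    using * v'(2) g'(2) unfolding ext_integral_def v' g'
    by (cases ?F; cases ?U) (auto simp: enn2ereal_ennreal ennreal_plus[symmetric] simp del: ennreal_plus)
qed

text \<open>Tonelli is applied to the positive and the negative part of \<open>V\<close>. The
  negative part is nondecreasing, so its averages stay below its integral, and the difference is
  never of the form \<infinity> - \<infinity>.\<close>

lemma
  assumes \<mu>: "\<mu> \<in> prob_measures"
    and V: "antimono_on {0<..<1} V" and int: "integrable unif V"
  shows ext_integral_average:
      "ext_integral \<mu> (\<lambda>\<alpha>. 1 / \<alpha> * (LBINT t:{0<..<\<alpha>}. V t)) =
        enn2ereal (\<integral>\<^sup>+t. ennreal (V t) * risk_spectrum \<mu> t \<partial>unif) -
        enn2ereal (\<integral>\<^sup>+t. ennreal (- V t) * risk_spectrum \<mu> t \<partial>unif)"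
    and nn_integral_neg_average_finite:
      "(\<integral>\<^sup>+t. ennreal (- V t) * risk_spectrum \<mu> t \<partial>unif) < \<top>"
proof -
  interpret prob_space \<mu> by (rule prob_measuresD(1)[OF \<mu>])
  have [measurable]: "V \<in> borel_measurable unif" using int by auto
  \<comment> \<open>As \<open>ennreal\<close> truncates at 0, \<open>A V\<close> averages the
    positive part of \<open>V\<close>, and \<open>A\<close> of \<open>-V\<close> its negative
    part.\<close>
  define A where "A h \<alpha> = ennreal (1 / \<alpha>) * (\<integral>\<^sup>+t. ennreal (h t) * indicator {..<\<alpha>} t \<partial>unif)"
    for h :: "real \<Rightarrow> real" and \<alpha>
  have A_fin: "A h \<alpha> < \<top>" if "integrable unif h" for h \<alpha>
  proof -
    have "(\<integral>\<^sup>+t. ennreal (h t) * indicator {..<\<alpha>} t \<partial>unif) \<le> (\<integral>\<^sup>+t. ennreal (h t) \<partial>unif)"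
      by (auto intro!: nn_integral_mono split: split_indicator)
    also have "\<dots> < \<top>"
      using that by (auto simp: real_integrable_def top.not_eq_extremum)
    finally show ?thesis
      unfolding A_def by (simp add: ennreal_mult_less_top)
  qed
  have A_meas [measurable]: "A h \<in> borel_measurable \<mu>" if "integrable unif h" for h
    unfolding A_def by (rule borel_measurable_average[OF \<mu>]) (use that in auto)
  have A_int: "(\<integral>\<^sup>+\<alpha>. ennreal (enn2real (A h \<alpha>)) \<partial>\<mu>) = (\<integral>\<^sup>+t. ennreal (h t) * risk_spectrum \<mu> t \<partial>unif)"
    if "integrable unif h" for h
  proof -
    have "(\<integral>\<^sup>+\<alpha>. ennreal (enn2real (A h \<alpha>)) \<partial>\<mu>) = (\<integral>\<^sup>+\<alpha>. A h \<alpha> \<partial>\<mu>)"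
      using A_fin[OF that] by simp
    then show ?thesis
      unfolding A_def by (subst (asm) nn_integral_average[OF \<mu>]) (use that in auto)
  qed
  have iV: "integrable unif (\<lambda>t. - V t)" using int by simp
  have "(\<integral>\<^sup>+\<alpha>. A (\<lambda>t. - V t) \<alpha> \<partial>\<mu>) \<le> (\<integral>\<^sup>+\<alpha>. (\<integral>\<^sup>+t. ennreal (- V t) \<partial>unif) \<partial>\<mu>)"
  proof (rule nn_integral_mono)
    fix \<alpha> assume "\<alpha> \<in> space \<mu>"
    then have \<alpha>: "0 < \<alpha>" "\<alpha> \<le> 1" by (auto simp: prob_measuresD(3)[OF \<mu>])
    have "A (\<lambda>t. - V t) \<alpha> \<le> ennreal (1 / \<alpha>) * (ennreal \<alpha> * (\<integral>\<^sup>+t. ennreal (- V t) \<partial>unif))"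
      unfolding A_def using V \<alpha>
      by (intro mult_left_mono average_mono_le) (auto simp: monotone_on_def intro!: ennreal_leI)
    also have "\<dots> = (\<integral>\<^sup>+t. ennreal (- V t) \<partial>unif)"
      using \<alpha> by (simp add: mult.assoc[symmetric] ennreal_mult[symmetric])
    finally show "A (\<lambda>t. - V t) \<alpha> \<le> (\<integral>\<^sup>+t. ennreal (- V t) \<partial>unif)" .
  qed
  also have "\<dots> = (\<integral>\<^sup>+t. ennreal (- V t) \<partial>unif)"
    by (simp add: emeasure_space_1)
  also have "\<dots> < \<top>"
    using int by (auto simp: real_integrable_def top.not_eq_extremum)
  finally have fin: "(\<integral>\<^sup>+\<alpha>. ennreal (enn2real (A (\<lambda>t. - V t) \<alpha>)) \<partial>\<mu>) < \<top>"
    using A_fin[OF iV] by simp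
  then show "(\<integral>\<^sup>+t. ennreal (- V t) * risk_spectrum \<mu> t \<partial>unif) < \<top>"
    unfolding A_int[OF iV] .
  have "1 / \<alpha> * (LBINT t:{0<..<\<alpha>}. V t) = enn2real (A V \<alpha>) - enn2real (A (\<lambda>t. - V t) \<alpha>)"
    if "\<alpha> \<in> space \<mu>" for \<alpha>
  proof -
    have \<alpha>: "0 < \<alpha>" "\<alpha> \<le> 1" using that by (auto simp: prob_measuresD(3)[OF \<mu>])
    have "(LBINT t:{0<..<\<alpha>}. V t) = (LBINT t:{0<..<1}. V t * indicator {..<\<alpha>} t)"
      unfolding set_lebesgue_integral_def using \<alpha>
      by (intro Bochner_Integration.integral_cong) (auto split: split_indicator)
    also have "\<dots> = (\<integral>t. V t * indicator {..<\<alpha>} t \<partial>unif)"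
      unfolding unif_def set_lebesgue_integral_def by (subst integral_restrict_space) auto
    also have "\<dots> = enn2real (\<integral>\<^sup>+t. ennreal (V t * indicator {..<\<alpha>} t) \<partial>unif) -
        enn2real (\<integral>\<^sup>+t. ennreal (- (V t * indicator {..<\<alpha>} t)) \<partial>unif)"
      by (rule real_lebesgue_integral_def, rule Bochner_Integration.integrable_bound[OF int])
        (auto split: split_indicator)
    also have "(\<integral>\<^sup>+t. ennreal (V t * indicator {..<\<alpha>} t) \<partial>unif) = (\<integral>\<^sup>+t. ennreal (V t) * indicator {..<\<alpha>} t \<partial>unif)"
      by (auto intro!: nn_integral_cong split: split_indicator)
    also have "(\<integral>\<^sup>+t. ennreal (- (V t * indicator {..<\<alpha>} t)) \<partial>unif) = (\<integral>\<^sup>+t. ennreal (- V t) * indicator {..<\<alpha>} t \<partial>unif)"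
      by (auto intro!: nn_integral_cong split: split_indicator)
    finally show ?thesis
      using \<alpha> by (simp add: A_def enn2real_mult right_diff_distrib)
  qed
  then have "ext_integral \<mu> (\<lambda>\<alpha>. 1 / \<alpha> * (LBINT t:{0<..<\<alpha>}. V t)) =
      enn2ereal (\<integral>\<^sup>+\<alpha>. ennreal (enn2real (A V \<alpha>)) \<partial>\<mu>) -
      enn2ereal (\<integral>\<^sup>+\<alpha>. ennreal (enn2real (A (\<lambda>t. - V t) \<alpha>)) \<partial>\<mu>)"
    using fin A_meas[OF int] A_meas[OF iV] by (intro ext_integral_eq_diff) auto
  then show "ext_integral \<mu> (\<lambda>\<alpha>. 1 / \<alpha> * (LBINT t:{0<..<\<alpha>}. V t)) =
        enn2ereal (\<integral>\<^sup>+t. ennreal (V t) * risk_spectrum \<mu> t \<partial>unif) -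
        enn2ereal (\<integral>\<^sup>+t. ennreal (- V t) * risk_spectrum \<mu> t \<partial>unif)"
    unfolding A_int[OF int] A_int[OF iV] .
qed

text \<open>Replaces extended integrals by a Bochner integral against a real version
  \<open>g\<close> of the spectrum. Agreement almost everywhere is the form in which the
  construction of a measure from a density delivers it.\<close>

lemma ext_integral_average_eq_integral:
  assumes \<mu>: "\<mu> \<in> prob_measures"
    and V: "antimono_on {0<..<1} V" and int: "integrable unif V"
    and g: "\<And>t. t \<in> {0<..<1} \<Longrightarrow> 0 \<le> g t" "AE t in unif. risk_spectrum \<mu> t = ennreal (g t)"
    and Vg: "integrable unif (\<lambda>t. V t * g t)"
  shows "ext_integral \<mu> (\<lambda>\<alpha>. 1 / \<alpha> * (LBINT t:{0<..<\<alpha>}. V t)) = ereal (\<integral>t. V t * g t \<partial>unif)"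
proof -
  have *: "(\<integral>\<^sup>+t. ennreal (h t) * risk_spectrum \<mu> t \<partial>unif) = (\<integral>\<^sup>+t. ennreal (h t * g t) \<partial>unif)"
    for h :: "real \<Rightarrow> real"
  proof (rule nn_integral_cong_AE)
    show "AE t in unif. ennreal (h t) * risk_spectrum \<mu> t = ennreal (h t * g t)"
      using g(2) AE_space
    proof eventually_elim
      case (elim t)
      then show ?case using g(1)[of t] by (simp add: ennreal_mult'')
    qed
  qed
  have pos: "(\<integral>\<^sup>+t. ennreal (V t * g t) \<partial>unif) \<noteq> \<infinity>" and neg: "(\<integral>\<^sup>+t. ennreal (- (V t * g t)) \<partial>unif) \<noteq> \<infinity>"
    using Vg by (auto simp: real_integrable_def)
  have *: "ext_integral \<mu> (\<lambda>\<alpha>. 1 / \<alpha> * (LBINT t:{0<..<\<alpha>}. V t)) =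
     enn2ereal (\<integral>\<^sup>+t. ennreal (V t * g t) \<partial>unif) - enn2ereal (\<integral>\<^sup>+t. ennreal (- (V t * g t)) \<partial>unif)"
    unfolding ext_integral_average[OF \<mu> V int] * by simp
  show ?thesis
    unfolding * real_lebesgue_integral_def[OF Vg] using pos neg
    by (cases "\<integral>\<^sup>+t. ennreal (V t * g t) \<partial>unif"; cases "\<integral>\<^sup>+t. ennreal (- (V t * g t)) \<partial>unif") auto
qed

text \<open>Layer cake: \<open>g\<close> is the integral over \<open>y > 0\<close> of the indicators
  of \<open>y < g t\<close>. By monotonicity each level set is an interval from 0 of length
  \<open>\<tau> y\<close>, up to its endpoint, so its indicator is \<open>\<tau> y\<close> times a
  uniform density. Hence \<mu> is the image under \<tau> of the measure with density \<tau> on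
  \<open>y > 0\<close>.\<close>

lemma ex_measure_with_risk_spectrum:
  assumes g: "antimono_on {0<..<1} g" "\<And>t. t \<in> {0<..<1} \<Longrightarrow> 0 \<le> g t"
    and g1: "(\<integral>\<^sup>+t. ennreal (g t) \<partial>unif) = 1"
  obtains \<mu> where "\<mu> \<in> prob_measures" "AE t in unif. risk_spectrum \<mu> t = ennreal (g t)"
proof -
  have [measurable]: "g \<in> borel_measurable unif"
    by (rule borel_measurable_unif_antimono[OF g(1)])
  define \<tau> where "\<tau> y = measure unif {t\<in>space unif. y < g t}" for y
  have ev: "{t\<in>space unif. y < g t} \<in> sets unif" for y
    by measurable
  have "mono (\<lambda>y. - \<tau> y)"
    using ev unfolding \<tau>_def mono_def by (auto intro!: unif.finite_measure_mono)
  then have "(\<lambda>y. - \<tau> y) \<in> borel_measurable borel"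
    by (rule borel_measurable_mono)
  then have "(\<lambda>y. - (- \<tau> y)) \<in> borel_measurable borel"
    by (rule borel_measurable_uminus)
  then have [measurable]: "\<tau> \<in> borel_measurable borel"
    by simp
  have \<tau>: "0 \<le> \<tau> y" "\<tau> y \<le> 1" for y
    unfolding \<tau>_def by auto
  \<comment> \<open>If \<open>t\<close> missed the level set, monotonicity would put the whole set
    to the left of \<open>t\<close>, making its length at most \<open>t\<close>.\<close>
  have \<tau>_less: "y < g t" if "t \<in> {0<..<1}" "t < \<tau> y" for t y
  proof (rule ccontr)
    assume "\<not> y < g t"
    have "t' < t" if "t' \<in> {0<..<1}" "y < g t'" for t'
    proof (rule ccontr)
      assume "\<not> t' < t"
      then have "g t' \<le> g t"
        using g(1) that(1) \<open>t \<in> {0<..<1}\<close> by (auto simp: monotone_on_def)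
      with that(2) \<open>\<not> y < g t\<close> show False by simp
    qed
    then have "{t\<in>space unif. y < g t} \<subseteq> {t'\<in>space unif. t' < t}"
      by auto
    then have "\<tau> y \<le> measure unif {t'\<in>space unif. t' < t}"
      unfolding \<tau>_def by (rule unif.finite_measure_mono) measurable
    also have "\<dots> = t"
    proof -
      have "emeasure unif {t'\<in>space unif. t' < t} = (\<integral>\<^sup>+t'. indicator {..<t} t' \<partial>unif)"
        by (subst nn_integral_indicator[symmetric], measurable) (auto intro!: nn_integral_cong split: split_indicator)
      then show ?thesis
        using that by (simp add: measure_def emeasure_unif_lessThan)
    qed
    finally show False using that by simp
  qed
  \<comment> \<open>The default 1 keeps the map inside \<open>(0, 1]\<close>; it is taken only where
    the density of \<open>K\<close> vanishes.\<close>
  define \<tau>' where "\<tau>' y = (if 0 < \<tau> y then \<tau> y else 1)" for y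
  have [measurable]: "\<tau>' \<in> borel \<rightarrow>\<^sub>M restrict_space borel {0<..1}"
    unfolding \<tau>'_def using \<tau> by (intro measurable_restrict_space2) auto
  define K where "K = density lborel (\<lambda>y. ennreal (\<tau> y) * indicator {0<..} y)"
  define \<mu> where "\<mu> = distr K (restrict_space borel {0<..1}) \<tau>'"
  have [measurable]: "\<tau>' \<in> K \<rightarrow>\<^sub>M restrict_space borel {0<..1}"
    by (simp add: K_def)
  have \<mu>_int: "(\<integral>\<^sup>+\<alpha>. f \<alpha> \<partial>\<mu>) = (\<integral>\<^sup>+y. ennreal (\<tau> y) * indicator {0<..} y * f (\<tau>' y) \<partial>lborel)"
    if [measurable]: "f \<in> borel_measurable (restrict_space borel {0<..1})" for f
    unfolding \<mu>_def
    by (subst nn_integral_distr) (auto simp: K_def intro!: nn_integral_density)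
  interpret P: pair_sigma_finite lborel unif ..
  \<comment> \<open>By Tonelli, integrating the lengths of the level sets over \<open>y\<close>
    returns the integral of \<open>g\<close>.\<close>
  have "emeasure \<mu> (space \<mu>) = (\<integral>\<^sup>+y. ennreal (\<tau> y) * indicator {0<..} y \<partial>lborel)"
    using \<mu>_int[of "\<lambda>_. 1"] by simp
  also have "\<dots> = (\<integral>\<^sup>+y. (\<integral>\<^sup>+t. (if 0 < y \<and> y < g t then 1 else 0) \<partial>unif) \<partial>lborel)"
  proof (rule nn_integral_cong)
    fix y :: real
    have "(\<integral>\<^sup>+t. (if 0 < y \<and> y < g t then 1 else 0) \<partial>unif) =
        (\<integral>\<^sup>+t. indicator {0<..} y * indicator {t\<in>space unif. y < g t} t \<partial>unif)"
      by (auto intro!: nn_integral_cong split: split_indicator)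
    also have "\<dots> = ennreal (\<tau> y) * indicator {0<..} y"
      using ev[of y] by (subst nn_integral_cmult) (auto simp: \<tau>_def unif.emeasure_eq_measure mult.commute)
    finally show "ennreal (\<tau> y) * indicator {0<..} y = (\<integral>\<^sup>+t. (if 0 < y \<and> y < g t then 1 else 0) \<partial>unif)" ..
  qed
  also have "\<dots> = (\<integral>\<^sup>+t. (\<integral>\<^sup>+y. (if 0 < y \<and> y < g t then 1 else 0) \<partial>lborel) \<partial>unif)"
    by (rule P.Fubini'[symmetric]) measurable
  also have "\<dots> = (\<integral>\<^sup>+t. ennreal (g t) \<partial>unif)"
  proof (rule nn_integral_cong)
    fix t assume "t \<in> space unif"
    have "(\<integral>\<^sup>+y. (if 0 < y \<and> y < g t then 1 else 0) \<partial>lborel) = (\<integral>\<^sup>+y. indicator {0<..<g t} y \<partial>lborel)"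
      by (rule nn_integral_cong) (auto split: split_indicator)
    then show "(\<integral>\<^sup>+y. (if 0 < y \<and> y < g t then 1 else 0) \<partial>lborel) = ennreal (g t)"
      using g(2) \<open>t \<in> space unif\<close> by simp
  qed
  finally have "emeasure \<mu> (space \<mu>) = 1" using g1 by simp
  then have \<mu>: "\<mu> \<in> prob_measures"
    by (simp add: space_prob_algebra prob_spaceI) (simp add: \<mu>_def)
  note [measurable] = borel_imp_unif[OF borel_measurable_risk_spectrum[OF \<mu>]]
  \<comment> \<open>The density \<tau> cancels the factor \<open>1 / \<tau>' y\<close>, and the
    levels \<open>y\<close> that remain lie below \<open>g t\<close>.\<close>
  have le: "risk_spectrum \<mu> t \<le> ennreal (g t)" if t: "t \<in> {0<..<1}" for t
  proof -
    have "risk_spectrum \<mu> t = (\<integral>\<^sup>+y. ennreal (\<tau> y) * indicator {0<..} y * (ennreal (1 / \<tau>' y) * indicator {t<..} (\<tau>' y)) \<partial>lborel)"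
      unfolding risk_spectrum_def by (rule \<mu>_int) (auto intro!: measurable_restrict_space1)
    also have "\<dots> \<le> (\<integral>\<^sup>+y. indicator {0<..<g t} y \<partial>lborel)"
    proof (rule nn_integral_mono)
      fix y :: real
      show "ennreal (\<tau> y) * indicator {0<..} y * (ennreal (1 / \<tau>' y) * indicator {t<..} (\<tau>' y)) \<le> indicator {0<..<g t} y"
        using \<tau>(1)[of y] \<tau>_less[OF t, of y]
        by (auto simp: \<tau>'_def ennreal_mult[symmetric] split: split_indicator simp flip: ennreal_1)
    qed
    also have "\<dots> = ennreal (g t)" using g(2)[OF t] by simp
    finally show ?thesis .
  qed
  \<comment> \<open>Domination and equal total mass 1 force equality almost everywhere, so the
    endpoints of the level sets need not be decided.\<close>
  have "(\<integral>\<^sup>+t. (ennreal (g t) - risk_spectrum \<mu> t) \<partial>unif) = 0"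
    by (subst nn_integral_diff) (auto simp: g1 nn_integral_risk_spectrum[OF \<mu>] le)
  then have "AE t in unif. ennreal (g t) - risk_spectrum \<mu> t = 0"
    by (subst (asm) nn_integral_0_iff_AE) auto
  then have "AE t in unif. risk_spectrum \<mu> t = ennreal (g t)"
    using AE_space
  proof eventually_elim
    case (elim t)
    then show ?case using le[of t] by (auto simp: ennreal_minus_eq_0 intro: antisym)
  qed
  with \<mu> show thesis by (rule that)
qed

section \<open>Duality bounds\<close>

lemma powr_conj_exponent:
  fixes p q :: real
  assumes "p > 1" "1 / q + 1 / p = 1"
  shows "q > 1" "(p - 1) * q = p" "p / q = p - 1" "1 - 1 / q = 1 / p"
proof -
  have "0 < 1 / p" "1 / p < 1" using assms(1) by auto
  then have *: "0 < 1 / q" "1 / q < 1" using assms(2) by linarith+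
  from *(1) have q0: "0 < q" by simp
  with *(2) show q: "q > 1" by simp
  have "1 / q = 1 - 1 / p" using assms(2) by linarith
  also have "\<dots> = (p - 1) / p"
    using assms(1) by (simp add: diff_divide_distrib)
  finally have q_eq: "q = p / (p - 1)"
    by (metis inverse_divide inverse_eq_divide inverse_inverse_eq)
  show "(p - 1) * q = p" "p / q = p - 1"
    unfolding q_eq using assms(1) by simp_all
  show "1 - 1 / q = 1 / p" using assms(2) by linarith
qed

text \<open>Young's inequality for \<open>f / N\<close> and \<open>g / c\<close>, with
  \<open>N\<close> the \<open>p\<close>-norm of \<open>f\<close>, bounds their product integral by
  \<open>1 / p + 1 / q = 1\<close>. If the norm vanishes, so does \<open>f * g\<close> almost
  everywhere. The bound \<open>c\<close> on the \<open>q\<close>-norm has the form of the constraint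
  in \<open>M_set\<close>.\<close>

lemma Hoelder_inequality:
  fixes f g :: "'a \<Rightarrow> real"
  assumes pq: "p > 1" "1 / q + 1 / p = 1"
    and [measurable]: "f \<in> borel_measurable M" "g \<in> borel_measurable M"
    and nn: "\<And>x. x \<in> space M \<Longrightarrow> 0 \<le> f x" "\<And>x. x \<in> space M \<Longrightarrow> 0 \<le> g x"
    and f: "integrable M (\<lambda>x. f x powr p)"
    and g: "integrable M (\<lambda>x. g x powr q)" "(\<integral>x. g x powr q \<partial>M) \<le> c powr q"
    and c: "c > 0"
  shows "integrable M (\<lambda>x. f x * g x)"
    and "(\<integral>x. f x * g x \<partial>M) \<le> c * (\<integral>x. f x powr p \<partial>M) powr (1 / p)"
proof -
  have q: "q > 1" by (rule powr_conj_exponent[OF pq])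
  have pq': "1 / p + 1 / q = 1" using pq by simp
  have young: "f x * g x \<le> f x powr p / p + g x powr q / q" if "x \<in> space M" for x
    using Youngs_inequality[OF pq(1) q pq'] nn[OF that] by simp
  show fg: "integrable M (\<lambda>x. f x * g x)"
  proof (rule Bochner_Integration.integrable_bound)
    show "integrable M (\<lambda>x. f x powr p / p + g x powr q / q)"
      using f g by auto
    show "AE x in M. norm (f x * g x) \<le> norm (f x powr p / p + g x powr q / q)"
      using nn young pq q by (intro AE_I2) (smt (verit) mult_nonneg_nonneg real_norm_def)
  qed measurable
  define A where "A = (\<integral>x. f x powr p \<partial>M)"
  have A: "0 \<le> A" unfolding A_def by simp
  show "(\<integral>x. f x * g x \<partial>M) \<le> c * (\<integral>x. f x powr p \<partial>M) powr (1 / p)"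
  proof (cases "A = 0")
    case True
    then have "AE x in M. f x powr p = 0"
      unfolding A_def using f by (subst (asm) integral_nonneg_eq_0_iff_AE) auto
    then have "AE x in M. f x * g x = 0"
      by eventually_elim auto
    then have "(\<integral>x. f x * g x \<partial>M) = 0"
      by (rule integral_eq_zero_AE)
    then show ?thesis using c by simp
  next
    case False
    define N where "N = A powr (1 / p)"
    have N: "N > 0" "N powr p = A"
      using A False pq by (auto simp: N_def powr_powr)
    have "(\<integral>x. f x * g x \<partial>M) / (N * c) = (\<integral>x. (f x / N) * (g x / c) \<partial>M)"
      by (simp flip: Bochner_Integration.integral_divide_zero)
    also have "\<dots> \<le> (\<integral>x. f x powr p / (A * p) + g x powr q / (c powr q * q) \<partial>M)"
    proof (rule integral_mono)
      show "integrable M (\<lambda>x. (f x / N) * (g x / c))"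
        using fg by (simp add: integrable_divide_zero)
      show "integrable M (\<lambda>x. f x powr p / (A * p) + g x powr q / (c powr q * q))"
        using f g by auto
      fix x assume "x \<in> space M"
      then have "(f x / N) * (g x / c) \<le> (f x / N) powr p / p + (g x / c) powr q / q"
        using nn N c by (intro Youngs_inequality pq q pq') auto
      then show "(f x / N) * (g x / c) \<le> f x powr p / (A * p) + g x powr q / (c powr q * q)"
        by (simp add: powr_divide N)
    qed
    also have "\<dots> = 1 / p + (\<integral>x. g x powr q \<partial>M) / c powr q / q"
      using f g False by (simp add: A_def[symmetric])
    also have "\<dots> \<le> 1 / p + 1 / q"
      using g c q by (intro add_left_mono divide_right_mono) (auto simp: divide_le_eq)
    also have "\<dots> = 1" by fact
    finally show ?thesis
      using N c by (simp add: divide_le_eq N_def A_def mult.commute)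
  qed
qed

text \<open>Convexity of the power on the closed half line. At a zero argument it reduces to
  \<open>w powr r \<le> w\<close> for weights in \<open>[0, 1]\<close>.\<close>

lemma powr_convex_combination:
  fixes x y u v r :: real
  assumes "r > 1" "0 \<le> x" "0 \<le> y" "0 \<le> u" "0 \<le> v" "u + v = 1"
  shows "(u * x + v * y) powr r \<le> u * x powr r + v * y powr r"
proof -
  have le: "w powr r \<le> w" if "0 \<le> w" "w \<le> 1" for w :: real
    using powr_mono'[of 1 r w] that assms by (cases "w = 0") auto
  consider "x = 0" | "y = 0" | "x > 0" "y > 0" using assms by linarith
  then show ?thesis
  proof cases
    case 1
    then show ?thesis using le[of v] assms by (auto simp: powr_mult intro!: mult_right_mono)
  next
    case 2
    then show ?thesis using le[of u] assms by (auto simp: powr_mult intro!: mult_right_mono)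
  next
    case 3
    then show ?thesis
      using powr_convex[of r] assms by (auto simp: convex_on_def)
  qed
qed

section \<open>Passing between measures and densities with a bounded \<open>q\<close>-th
  moment\<close>

lemma risk_spectrum_finite:
  assumes "\<mu> \<in> prob_measures" "0 < t"
  shows "risk_spectrum \<mu> t < \<top>"
proof -
  interpret prob_space \<mu> by (rule prob_measuresD(1)[OF assms(1)])
  have "risk_spectrum \<mu> t \<le> (\<integral>\<^sup>+\<alpha>. ennreal (1 / t) \<partial>\<mu>)"
    unfolding risk_spectrum_def using assms(2)
    by (intro nn_integral_mono) (auto split: split_indicator intro!: ennreal_leI simp: field_simps)
  also have "\<dots> < \<top>" by (simp add: emeasure_space_1)
  finally show ?thesis .
qed

lemma M_set_iff:
  "\<mu> \<in> M_set c q \<longleftrightarrow> \<mu> \<in> prob_measures \<and>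
    (\<integral>\<^sup>+t. ennreal (enn2real (risk_spectrum \<mu> t) powr q) \<partial>unif) \<le> ennreal (c powr q)"
proof -
  have *: "(LINT t:{\<alpha><..1}|\<mu>. 1 / t) = enn2real (risk_spectrum \<mu> \<alpha>)"
    if \<mu>: "\<mu> \<in> prob_measures" and "\<alpha> \<in> {0<..<1}" for \<alpha>
  proof -
    have m: "(\<lambda>t. indicator {\<alpha><..1} t *\<^sub>R (1 / t)) \<in> borel_measurable \<mu>"
      unfolding measurable_cong_sets[OF prob_measuresD(2)[OF \<mu>] refl]
      by (intro measurable_restrict_space1) measurable
    show ?thesis
      unfolding set_lebesgue_integral_def risk_spectrum_def using that(2)
      by (subst integral_eq_nn_integral[OF m])
        (auto simp: prob_measuresD(3)[OF \<mu>] split: split_indicator intro!: arg_cong[where f=enn2real] nn_integral_cong)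
  qed
  have **: "(\<integral>\<^sup>+\<alpha>\<in>{0<..<1}. ennreal (\<bar>LINT t:{\<alpha><..1}|\<mu>. 1 / t\<bar> powr q) \<partial>lborel) =
     (\<integral>\<^sup>+t. ennreal (enn2real (risk_spectrum \<mu> t) powr q) \<partial>unif)"
    if \<mu>: "\<mu> \<in> prob_measures"
    unfolding nn_integral_unif using *[OF \<mu>]
    by (intro nn_integral_cong) (auto split: split_indicator)
  show ?thesis
    unfolding M_set_def using ** by auto
qed

abbreviation average :: "(real \<Rightarrow> real) \<Rightarrow> real \<Rightarrow> real" where
  "average V \<alpha> \<equiv> 1 / \<alpha> * (LBINT t:{0<..<\<alpha>}. V t)"

lemma lp_norm_max:
  assumes "integrable M (\<lambda>x. max (f x) 0 powr p)" "f \<in> borel_measurable M"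
  shows "lp_norm M p (\<lambda>x. max (f x) 0) = ereal ((\<integral>x. max (f x) 0 powr p \<partial>M) powr (1 / p))"
  using assms by (simp add: lp_norm_def)

text \<open>Weak duality: since \<open>g\<close> has mass 1, the integral of \<open>V * g\<close> is
  that of \<open>(s + V) * g\<close> minus \<open>s\<close>. Enlarging \<open>s + V\<close> to its
  positive part makes Hoelder applicable.\<close>

lemma ext_integral_average_le:
  assumes \<mu>: "\<mu> \<in> M_set c q" and pq: "p > 1" "1 / q + 1 / p = 1" and c: "c > 0"
    and V: "antimono_on {0<..<1} V" and int: "integrable unif V"
  shows "ext_integral \<mu> (average V) \<le> ereal c * lp_norm unif p (\<lambda>t. max (s + V t) 0) - ereal s"
proof (cases "integrable unif (\<lambda>t. max (s + V t) 0 powr p)")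
  case False
  \<comment> \<open>Here the norm, and with it the right-hand side, is infinite.\<close>
  then show ?thesis using c by (simp add: lp_norm_def)
next
  case True
  have [measurable]: "V \<in> borel_measurable unif" using int by auto
  have \<mu>': "\<mu> \<in> prob_measures" using \<mu> by (simp add: M_set_iff)
  note [measurable] = borel_imp_unif[OF borel_measurable_risk_spectrum[OF \<mu>']]
  define g where "g t = enn2real (risk_spectrum \<mu> t)" for t
  have [measurable]: "g \<in> borel_measurable unif" unfolding g_def by measurable
  have g0: "0 \<le> g t" for t by (simp add: g_def)
  have g: "ennreal (g t) = risk_spectrum \<mu> t" if "t \<in> {0<..<1}" for t
    using risk_spectrum_finite[OF \<mu>', of t] that by (simp add: g_def)
  have gI: "(\<integral>\<^sup>+t. ennreal (g t) \<partial>unif) = 1"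
    using nn_integral_risk_spectrum[OF \<mu>'] by (subst nn_integral_cong[OF g]) auto
  have g_int: "integrable unif g" "(\<integral>t. g t \<partial>unif) = 1"
    using gI by (auto intro!: integrableI_nonneg simp: g0 integral_eq_nn_integral)
  have gq: "(\<integral>\<^sup>+t. ennreal (g t powr q) \<partial>unif) \<le> ennreal (c powr q)"
    using \<mu> by (simp add: M_set_iff g_def)
  have gq_int: "integrable unif (\<lambda>t. g t powr q)"
    using gq by (intro integrableI_nonneg) (auto intro: le_less_trans)
  have gq_le: "(\<integral>t. g t powr q \<partial>unif) \<le> c powr q"
    using gq gq_int by (subst (asm) nn_integral_eq_integral) auto
  let ?Z = "\<lambda>t. max (s + V t) 0"
  have Zg: "integrable unif (\<lambda>t. ?Z t * g t)"
    and Zg_le: "(\<integral>t. ?Z t * g t \<partial>unif) \<le> c * (\<integral>t. ?Z t powr p \<partial>unif) powr (1 / p)"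
    by (rule Hoelder_inequality[OF pq _ _ _ _ _ gq_int gq_le c]; use True g0 in simp)+
  have Vg_le: "V t * g t \<le> ?Z t * g t - s * g t" for t
    using mult_right_mono[OF max.cobounded1[of "s + V t" 0] g0[of t]] by (simp add: algebra_simps)
  \<comment> \<open>The Hoelder bound controls \<open>V * g\<close> only from above; its negative
    part is finite by the monotonicity of \<open>V\<close>.\<close>
  have Vg: "integrable unif (\<lambda>t. V t * g t)"
    unfolding real_integrable_def
  proof (intro conjI)
    have "(\<integral>\<^sup>+t. ennreal (V t * g t) \<partial>unif) \<le> (\<integral>\<^sup>+t. ennreal (?Z t * g t - s * g t) \<partial>unif)"
      by (intro nn_integral_mono ennreal_leI Vg_le)
    also have "\<dots> < \<top>"
      using Bochner_Integration.integrable_diff[OF Zg integrable_mult_right[OF g_int(1), of s]]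
      by (simp add: real_integrable_def top.not_eq_extremum)
    finally show "(\<integral>\<^sup>+t. ennreal (V t * g t) \<partial>unif) \<noteq> \<infinity>" by simp
    have "(\<integral>\<^sup>+t. ennreal (- (V t * g t)) \<partial>unif) = (\<integral>\<^sup>+t. ennreal (- V t) * risk_spectrum \<mu> t \<partial>unif)"
      by (rule nn_integral_cong) (simp add: g[symmetric] ennreal_mult''[symmetric] g0)
    then show "(\<integral>\<^sup>+t. ennreal (- (V t * g t)) \<partial>unif) \<noteq> \<infinity>"
      using nn_integral_neg_average_finite[OF \<mu>' V int] by simp
  qed measurable
  have "ext_integral \<mu> (average V) = ereal (\<integral>t. V t * g t \<partial>unif)"
    by (rule ext_integral_average_eq_integral[OF \<mu>' V int g0 _ Vg]) (rule AE_I2, simp add: g)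
  also have "(\<integral>t. V t * g t \<partial>unif) \<le> (\<integral>t. ?Z t * g t - s * g t \<partial>unif)"
    by (rule integral_mono[OF Vg _ Vg_le]) (use Zg g_int in auto)
  also have "\<dots> = (\<integral>t. ?Z t * g t \<partial>unif) - s"
    using Zg g_int by simp
  also have "\<dots> \<le> c * (\<integral>t. ?Z t powr p \<partial>unif) powr (1 / p) - s"
    using Zg_le by simp
  also have "ereal \<dots> = ereal c * lp_norm unif p ?Z - ereal s"
    using True by (simp add: lp_norm_max)
  finally show ?thesis by simp
qed

text \<open>Allows the supremum over measures to be tested with densities, each realised as the
  spectrum of an admissible measure.\<close>

lemma integral_le_SUP_average:
  assumes V: "antimono_on {0<..<1} V" and int: "integrable unif V"
    and g: "antimono_on {0<..<1} g" "\<And>t. t \<in> {0<..<1} \<Longrightarrow> 0 \<le> g t"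
    and g1: "integrable unif g" "(\<integral>t. g t \<partial>unif) = 1"
    and gq: "integrable unif (\<lambda>t. g t powr q)" "(\<integral>t. g t powr q \<partial>unif) \<le> c powr q"
    and Vg: "integrable unif (\<lambda>t. V t * g t)"
  shows "ereal (\<integral>t. V t * g t \<partial>unif) \<le> (SUP \<mu>\<in>M_set c q. ext_integral \<mu> (average V))"
proof -
  have "(\<integral>\<^sup>+t. ennreal (g t) \<partial>unif) = 1"
    using g1 g(2) by (subst nn_integral_eq_integral) auto
  then obtain \<mu> where \<mu>: "\<mu> \<in> prob_measures" "AE t in unif. risk_spectrum \<mu> t = ennreal (g t)"
    using ex_measure_with_risk_spectrum[OF g] by blast
  have "(\<integral>\<^sup>+t. ennreal (enn2real (risk_spectrum \<mu> t) powr q) \<partial>unif) = (\<integral>\<^sup>+t. ennreal (g t powr q) \<partial>unif)"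
  proof (rule nn_integral_cong_AE)
    show "AE t in unif. ennreal (enn2real (risk_spectrum \<mu> t) powr q) = ennreal (g t powr q)"
      using \<mu>(2) AE_space by eventually_elim (use g(2) in auto)
  qed
  also have "\<dots> \<le> ennreal (c powr q)"
    using gq by (subst nn_integral_eq_integral) (auto intro: ennreal_leI)
  finally have "\<mu> \<in> M_set c q"
    using \<mu>(1) by (simp add: M_set_iff)
  moreover have "ext_integral \<mu> (average V) = ereal (\<integral>t. V t * g t \<partial>unif)"
    by (rule ext_integral_average_eq_integral[OF \<mu>(1) V int g(2) \<mu>(2) Vg])
  ultimately show ?thesis
    by (intro SUP_upper2[of \<mu>]) auto
qed

section \<open>The minimax identity\<close>

text \<open>Supplies the dominating functions for the limits in \<open>s\<close>. A power
  \<open>r \<le> p\<close> is at most 1 plus the \<open>p\<close>-th power, and convexity with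
  weights 1/2 separates \<open>K\<close> from \<open>z\<close>.\<close>

lemma integrable_shift_powr:
  fixes z :: "real \<Rightarrow> real" and p r K :: real
  assumes [measurable]: "z \<in> borel_measurable unif"
    and z: "integrable unif (\<lambda>t. max (z t) 0 powr p)" and r: "0 \<le> r" "r \<le> p" and p: "p > 1" and K: "0 \<le> K"
  shows "integrable unif (\<lambda>t. (K + max (z t) 0) powr r)"
proof (rule Bochner_Integration.integrable_bound)
  show "integrable unif (\<lambda>t. 1 + (1 / 2 * (2 * K) powr p + 1 / 2 * (2 powr p * max (z t) 0 powr p)))"
    using z by simp
  show "AE t in unif. norm ((K + max (z t) 0) powr r)
      \<le> norm (1 + (1 / 2 * (2 * K) powr p + 1 / 2 * (2 powr p * max (z t) 0 powr p)))"
  proof (rule AE_I2)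
    fix t
    let ?w = "K + max (z t) 0"
    have "?w powr r \<le> 1 + ?w powr p"
    proof (cases "?w \<le> 1")
      case True
      then have "?w powr r \<le> 1" using K r by (intro powr_le1) auto
      then show ?thesis using powr_ge_zero[of ?w p] by linarith
    next
      case False
      then have "?w powr r \<le> ?w powr p" using r by (intro powr_mono) auto
      then show ?thesis by linarith
    qed
    also have "?w powr p \<le> 1 / 2 * (2 * K) powr p + 1 / 2 * (2 * max (z t) 0) powr p"
      using powr_convex_combination[of p "2 * K" "2 * max (z t) 0" "1 / 2" "1 / 2"] p K by simp
    also have "(2 * max (z t) 0) powr p = 2 powr p * max (z t) 0 powr p"
      by (rule powr_mult)
    finally show "norm (?w powr r) \<le> norm (1 + (1 / 2 * (2 * K) powr p + 1 / 2 * (2 powr p * max (z t) 0 powr p)))"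
      by simp
  qed
qed measurable

locale quantile_loss =
  fixes V :: "real \<Rightarrow> real" and p q c :: real
  assumes antimono: "antimono_on {0<..<1} V" and integrable: "integrable unif V"
    and p: "p > 1" and conj: "1 / q + 1 / p = 1" and c: "c > 1"
begin

abbreviation S :: ereal where "S \<equiv> (SUP \<mu>\<in>M_set c q. ext_integral \<mu> (average V))"

lemma V_measurable [measurable]: "V \<in> borel_measurable unif"
  using integrable by auto

lemma V_le: "0 < x \<Longrightarrow> x \<le> y \<Longrightarrow> y < 1 \<Longrightarrow> V y \<le> V x"
  using antimono by (auto simp: monotone_on_def)

lemma q: "q > 1"
  by (rule powr_conj_exponent[OF p conj])

text \<open>If the positive part of \<open>V\<close> is not \<open>p\<close>-integrable, the densities are perturbations of the
  constant \<open>1\<close> by a small multiple of the normalised dual functions of the truncations \<open>W n\<close>.\<close>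

lemma S_eq_infinity:
  assumes not_int: "\<not> integrable unif (\<lambda>t. max (V t) 0 powr p)"
  shows "S = \<infinity>"
proof (rule ccontr)
  assume fin: "S \<noteq> \<infinity>"
  define W where "W n t = min (max (V t) 0) (real n)" for n t
  have [measurable]: "W n \<in> borel_measurable unif" for n unfolding W_def by measurable
  have W: "0 \<le> W n t" "W n t \<le> real n" for n t by (auto simp: W_def)
  have W_bdd: "integrable unif (\<lambda>t. W n t powr r)" if "r \<ge> 0" for n r
    by (rule unif.integrable_const_bound[where B="real n powr r"])
      (use W that in \<open>auto intro!: powr_mono2\<close>)
  define A where "A n = (\<integral>t. W n t powr p \<partial>unif)" for n
  define d where "d = min (c - 1) 1"
  \<comment> \<open>The perturbation of size \<open>d\<close> yields a \<open>q\<close>-norm of at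
    most \<open>1 + d\<close>, hence the bound by \<open>c\<close>; \<open>d \<le> 1\<close> keeps
    the density nonnegative.\<close>
  have d: "0 < d" "d \<le> 1" "1 + d \<le> c" using c by (auto simp: d_def)
  have key: "ereal (d * A n powr (1 / p) - (\<integral>t. \<bar>V t\<bar> \<partial>unif)) \<le> S" if A: "A n > 0" for n
  proof -
    \<comment> \<open>The dual function of \<open>W n\<close>: it has \<open>q\<close>-norm 1, and
      its pairing with \<open>W n\<close> is the \<open>p\<close>-norm of
      \<open>W n\<close>.\<close>
    define h where "h t = W n t powr (p - 1) / A n powr (1 / q)" for t
    have h0: "0 \<le> h t" for t by (simp add: h_def)
    have h_meas [measurable]: "h \<in> borel_measurable unif" unfolding h_def by measurable
    have h_anti: "antimono_on {0<..<1} h"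
    proof (rule monotone_onI)
      fix x y :: real assume "x \<in> {0<..<1}" "y \<in> {0<..<1}" "x \<le> y"
      then have "W n y \<le> W n x" using V_le[of x y] by (auto simp: W_def)
      then show "h y \<le> h x"
        unfolding h_def using p W A by (intro divide_right_mono powr_mono2) auto
    qed
    have h_int: "integrable unif h"
      unfolding h_def using W_bdd[of "p - 1" n] p by simp
    have hq: "h t powr q = W n t powr p / A n" for t
      using powr_conj_exponent[OF p conj] A W by (simp add: h_def powr_divide powr_powr)
    have hq_int: "integrable unif (\<lambda>t. h t powr q)" "(\<integral>t. h t powr q \<partial>unif) = 1"
      unfolding hq using W_bdd[of p n] p A by (auto simp: A_def)
    define \<kappa> where "\<kappa> = (\<integral>t. h t \<partial>unif)"
    \<comment> \<open>Hoelder against the constant 1: on a probability space the mean is at most the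
      \<open>q\<close>-norm.\<close>
    have "\<kappa> \<le> 1"
      using Hoelder_inequality(2)[of p q "\<lambda>_. 1" unif h 1] p conj h0 hq_int
      by (simp add: \<kappa>_def)
    moreover have "0 \<le> \<kappa>" unfolding \<kappa>_def using h0 by simp
    ultimately have \<kappa>: "0 \<le> d * \<kappa>" "d * \<kappa> \<le> 1" using d by (auto intro: mult_le_one)
    define g where "g t = (1 - d * \<kappa>) + d * h t" for t
    have g_anti: "antimono_on {0<..<1} g"
      using h_anti d by (auto simp: g_def monotone_on_def)
    have g0: "0 \<le> g t" for t using \<kappa> d h0 by (simp add: g_def)
    have g1: "integrable unif g" "(\<integral>t. g t \<partial>unif) = 1"
      using h_int unfolding g_def by (auto simp: \<kappa>_def unif.prob_space)
    have g_le: "g t powr q \<le> (1 + d) powr q * (1 / (1 + d) + d / (1 + d) * h t powr q)" for t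
    proof -
      \<comment> \<open>Weights \<open>1 / (1 + d)\<close> and \<open>d / (1 + d)\<close> turn the
        triangle inequality for the \<open>q\<close>-norm into pointwise convexity.\<close>
      have "g t = (1 + d) * (1 / (1 + d) * (1 - d * \<kappa>) + d / (1 + d) * h t)"
        using d by (simp add: g_def distrib_left)
      then have "g t powr q = (1 + d) powr q * (1 / (1 + d) * (1 - d * \<kappa>) + d / (1 + d) * h t) powr q"
        by (simp only: powr_mult)
      also have "(1 / (1 + d) * (1 - d * \<kappa>) + d / (1 + d) * h t) powr q
          \<le> 1 / (1 + d) * (1 - d * \<kappa>) powr q + d / (1 + d) * h t powr q"
        using d \<kappa> h0 q by (intro powr_convex_combination) (auto simp flip: add_divide_distrib)
      also have "(1 - d * \<kappa>) powr q \<le> 1"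
        using \<kappa> q by (intro powr_le1) auto
      finally show ?thesis
        using d by (simp add: mult_left_mono divide_right_mono)
    qed
    have bound_int: "integrable unif (\<lambda>t. (1 + d) powr q * (1 / (1 + d) + d / (1 + d) * h t powr q))"
      using hq_int by auto
    have [measurable]: "g \<in> borel_measurable unif" using g1 by auto
    have gq: "integrable unif (\<lambda>t. g t powr q)"
      by (rule Bochner_Integration.integrable_bound[OF bound_int])
        (use order_trans[OF g_le abs_ge_self] in simp_all)
    have "(\<integral>t. g t powr q \<partial>unif) \<le> (\<integral>t. (1 + d) powr q * (1 / (1 + d) + d / (1 + d) * h t powr q) \<partial>unif)"
      by (rule integral_mono[OF gq bound_int g_le])
    also have "\<dots> = (1 + d) powr q * (1 / (1 + d) + d / (1 + d))"
      using hq_int by (simp add: unif.prob_space)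
    also have "\<dots> = (1 + d) powr q"
      using d by (simp flip: add_divide_distrib)
    also have "\<dots> \<le> c powr q"
      using d q by (intro powr_mono2) auto
    finally have gq_le: "(\<integral>t. g t powr q \<partial>unif) \<le> c powr q" .
    \<comment> \<open>Truncation at \<open>n\<close> bounds \<open>h\<close>, so integrability of
      \<open>V\<close> alone makes \<open>V * h\<close> integrable.\<close>
    define B where "B = real n powr (p - 1) / A n powr (1 / q)"
    have h_bdd: "h t \<le> B" for t
      unfolding h_def B_def using W p by (intro divide_right_mono powr_mono2) auto
    have Vh: "integrable unif (\<lambda>t. V t * h t)"
      by (rule Bochner_Integration.integrable_bound[where f="\<lambda>t. V t * B"])
        (use integrable h0 order_trans[OF h_bdd abs_ge_self] in \<open>auto intro!: mult_left_mono simp: abs_mult\<close>)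
    have Vh_ge: "W n t powr p / A n powr (1 / q) \<le> V t * h t" for t
    proof (cases "V t > 0")
      case True
      have "W n t powr p = W n t * W n t powr (p - 1)"
        using W p by (simp add: powr_mult_base)
      also have "\<dots> \<le> V t * W n t powr (p - 1)"
        using True by (intro mult_right_mono) (auto simp: W_def)
      finally show ?thesis by (simp add: h_def divide_right_mono)
    next
      case False
      then have "W n t = 0" by (simp add: W_def)
      then show ?thesis by (simp add: h_def)
    qed
    have "A n powr (1 / p) = A n powr (1 - 1 / q)"
      by (simp add: powr_conj_exponent[OF p conj])
    also have "\<dots> = A n / A n powr (1 / q)"
      using A by (simp add: powr_diff)
    also have "\<dots> = (\<integral>t. W n t powr p / A n powr (1 / q) \<partial>unif)"
      by (simp add: A_def)
    also have "\<dots> \<le> (\<integral>t. V t * h t \<partial>unif)"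
      using W_bdd[of p n] p by (intro integral_mono Vh Vh_ge) auto
    finally have 1: "A n powr (1 / p) \<le> (\<integral>t. V t * h t \<partial>unif)" .
    have eq: "(\<lambda>t. V t * g t) = (\<lambda>t. (1 - d * \<kappa>) * V t + d * (V t * h t))"
      by (auto simp: g_def algebra_simps)
    have "\<bar>(1 - d * \<kappa>) * (\<integral>t. V t \<partial>unif)\<bar> \<le> 1 * (\<integral>t. \<bar>V t\<bar> \<partial>unif)"
      unfolding abs_mult using \<kappa> integral_abs_bound[of unif V] by (intro mult_mono) auto
    then have "d * A n powr (1 / p) - (\<integral>t. \<bar>V t\<bar> \<partial>unif)
        \<le> (1 - d * \<kappa>) * (\<integral>t. V t \<partial>unif) + d * (\<integral>t. V t * h t \<partial>unif)"
      using mult_left_mono[OF 1, of d] d by linarith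
    also have "\<dots> = (\<integral>t. V t * g t \<partial>unif)"
      unfolding eq using integrable Vh by simp
    finally have "ereal (d * A n powr (1 / p) - (\<integral>t. \<bar>V t\<bar> \<partial>unif)) \<le> ereal (\<integral>t. V t * g t \<partial>unif)"
      by simp
    also have "\<dots> \<le> S"
      by (rule integral_le_SUP_average[OF antimono integrable g_anti g0 g1 gq gq_le])
        (unfold eq, use integrable Vh in auto)
    finally show ?thesis .
  qed
  \<comment> \<open>Were \<open>S\<close> finite, the lower bounds \<open>key\<close> would bound
    all \<open>A n\<close>. Monotone convergence then makes the positive part of \<open>V\<close>
    \<open>p\<close>-integrable, a contradiction.\<close>
  obtain R where R: "\<And>n. A n \<le> R"
  proof -
    obtain \<sigma> where \<sigma>: "S \<le> ereal \<sigma>"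
      using fin by (cases S) auto
    have "A n \<le> ((\<bar>\<sigma>\<bar> + (\<integral>t. \<bar>V t\<bar> \<partial>unif)) / d) powr p" for n
    proof (cases "A n > 0")
      case True
      have "d * A n powr (1 / p) - (\<integral>t. \<bar>V t\<bar> \<partial>unif) \<le> \<sigma>"
        using order_trans[OF key[OF True] \<sigma>] by simp
      then have "A n powr (1 / p) \<le> (\<bar>\<sigma>\<bar> + (\<integral>t. \<bar>V t\<bar> \<partial>unif)) / d"
        using d by (auto simp: field_simps)
      then have "(A n powr (1 / p)) powr p \<le> ((\<bar>\<sigma>\<bar> + (\<integral>t. \<bar>V t\<bar> \<partial>unif)) / d) powr p"
        using p by (intro powr_mono2) auto
      then show ?thesis using True p by (simp add: powr_powr)
    next
      case False
      then show ?thesis by (meson not_less order_trans powr_ge_zero)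
    qed
    then show thesis by (rule that)
  qed
  have "(\<lambda>n. \<integral>\<^sup>+t. ennreal (W n t powr p) \<partial>unif) \<longlonglongrightarrow> (\<integral>\<^sup>+t. ennreal (max (V t) 0 powr p) \<partial>unif)"
  proof (rule nn_integral_LIMSEQ)
    show "incseq (\<lambda>n t. ennreal (W n t powr p))"
      using p by (auto simp: incseq_def le_fun_def W_def intro!: ennreal_leI powr_mono2)
    fix t
    have "W n t = max (V t) 0" if "n \<ge> nat \<lceil>max (V t) 0\<rceil>" for n
      using that unfolding W_def by linarith
    then show "(\<lambda>n. ennreal (W n t powr p)) \<longlonglongrightarrow> ennreal (max (V t) 0 powr p)"
      by (intro tendsto_eventually eventually_sequentiallyI[of "nat \<lceil>max (V t) 0\<rceil>"]) auto
  qed measurable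
  moreover have "(\<integral>\<^sup>+t. ennreal (W n t powr p) \<partial>unif) \<le> ennreal R" for n
    using R[of n] W_bdd[of p n] p by (subst nn_integral_eq_integral) (auto simp: A_def intro: ennreal_leI)
  ultimately have "(\<integral>\<^sup>+t. ennreal (max (V t) 0 powr p) \<partial>unif) \<le> ennreal R"
    by (intro LIMSEQ_le_const2) auto
  then have "integrable unif (\<lambda>t. max (V t) 0 powr p)"
    by (intro integrableI_nonneg) (auto intro: le_less_trans)
  with not_int show False by simp
qed

section \<open>Moments of the positive part of \<open>s + V\<close> as functions of the
  shift\<close>

definition moment :: "real \<Rightarrow> real \<Rightarrow> real" where
  "moment r s = (\<integral>t. max (s + V t) 0 powr r \<partial>unif)"

lemma moment_nonneg: "0 \<le> moment r s"
  by (simp add: moment_def)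

context
  assumes Lp: "integrable unif (\<lambda>t. max (V t) 0 powr p)"
begin

lemma integrable_moment:
  assumes "0 \<le> r" "r \<le> p"
  shows "integrable unif (\<lambda>t. max (s + V t) 0 powr r)"
proof (rule Bochner_Integration.integrable_bound)
  show "integrable unif (\<lambda>t. (\<bar>s\<bar> + max (V t) 0) powr r)"
    by (rule integrable_shift_powr[OF _ Lp assms p]) auto
  show "AE t in unif. norm (max (s + V t) 0 powr r) \<le> norm ((\<bar>s\<bar> + max (V t) 0) powr r)"
    using assms by (auto intro!: AE_I2 powr_mono2)
qed measurable

lemma moment_mono: "moment r s \<le> moment r s'" if "s \<le> s'" "0 \<le> r" "r \<le> p"
  unfolding moment_def using that by (intro integral_mono integrable_moment powr_mono2) auto

text \<open>Dominated convergence along sequences: a convergent sequence of shifts is bounded by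
  some \<open>K\<close>, which gives the majorant. The exponent is positive so that the power is
  continuous at 0.\<close>

lemma isCont_moment:
  assumes r: "0 < r" "r \<le> p"
  shows "isCont (moment r) a"
  unfolding continuous_at_sequentially
proof (intro allI impI)
  fix x assume x: "x \<longlonglongrightarrow> a"
  then obtain K where K: "\<And>n. \<bar>x n\<bar> \<le> K"
    by (metis Bseq_def convergentI convergent_imp_Bseq real_norm_def)
  have K0: "0 \<le> K" using K[of 0] by linarith
  show "(moment r \<circ> x) \<longlonglongrightarrow> moment r a"
    unfolding moment_def o_def
  proof (rule integral_dominated_convergence)
    show "integrable unif (\<lambda>t. (K + max (V t) 0) powr r)"
      using r by (intro integrable_shift_powr[OF _ Lp _ _ p K0]) auto
    show "AE t in unif. (\<lambda>n. max (x n + V t) 0 powr r) \<longlonglongrightarrow> max (a + V t) 0 powr r"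
      using r by (intro AE_I2 tendsto_powr' tendsto_max tendsto_add x tendsto_const) auto
    show "AE t in unif. norm (max (x n + V t) 0 powr r) \<le> (K + max (V t) 0) powr r" for n
      using r K[of n] K0 by (auto intro!: AE_I2 powr_mono2)
  qed measurable
qed

text \<open>The positive part of \<open>1 + V / s\<close> tends to 1 and is dominated by 1 plus the
  positive part of \<open>V\<close>. Sampling at \<open>Suc n\<close> avoids division by 0.\<close>

lemma moment_scaled_tendsto:
  assumes r: "0 < r" "r \<le> p"
  shows "(\<lambda>n. moment r (real (Suc n)) / real (Suc n) powr r) \<longlonglongrightarrow> 1"
proof -
  have eq: "max (real (Suc n) + v) 0 powr r / real (Suc n) powr r = max (1 + v / real (Suc n)) 0 powr r" for n v
  proof -
    have "max (real (Suc n) + v) 0 / real (Suc n) = max (1 + v / real (Suc n)) 0"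
      by (subst max_divide_distrib_right) (simp add: add_divide_distrib)
    then show ?thesis by (simp only: powr_divide[symmetric])
  qed
  have "(\<lambda>n. \<integral>t. max (1 + V t / real (Suc n)) 0 powr r \<partial>unif) \<longlonglongrightarrow> (\<integral>t. 1 \<partial>unif)"
  proof (rule integral_dominated_convergence)
    show "integrable unif (\<lambda>t. (1 + max (V t) 0) powr r)"
      using r by (intro integrable_shift_powr[OF _ Lp _ _ p]) auto
    have "(\<lambda>n. max (1 + V t / real (Suc n)) 0 powr r) \<longlonglongrightarrow> max (1 + 0) 0 powr r" for t
      using r by (intro tendsto_powr' tendsto_max tendsto_add tendsto_const
          LIMSEQ_Suc[OF lim_const_over_n]) auto
    then show "AE t in unif. (\<lambda>n. max (1 + V t / real (Suc n)) 0 powr r) \<longlonglongrightarrow> 1"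
      by (intro AE_I2) simp
    have "V t / real (Suc n) \<le> max (V t) 0" for t n
      using frac_le[of "max (V t) 0" "V t" 1 "real (Suc n)"] by simp
    then show "AE t in unif. norm (max (1 + V t / real (Suc n)) 0 powr r) \<le> (1 + max (V t) 0) powr r" for n
      using r by (auto intro!: AE_I2 powr_mono2)
  qed measurable
  then show ?thesis
    by (simp add: moment_def eq unif.prob_space del: of_nat_Suc flip: Bochner_Integration.integral_divide_zero)
qed

text \<open>The sign of this function is that of the derivative in \<open>s\<close> of the objective in the
  definition of \<open>T_bar\<close>.\<close>

definition slope :: "real \<Rightarrow> real" where
  "slope s = c * moment (p - 1) s - moment p s powr (1 / q)"

lemma isCont_slope: "isCont slope a"
proof -
  have 1: "((\<lambda>s. moment p s powr (1 / q)) \<longlongrightarrow> moment p a powr (1 / q)) (at a)"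
    using isCont_moment[of p a] p q
    by (intro tendsto_powr' tendsto_const) (auto simp: isCont_def moment_nonneg)
  have 2: "(moment (p - 1) \<longlongrightarrow> moment (p - 1) a) (at a)"
    using isCont_moment[of "p - 1" a] p by (auto simp: isCont_def)
  show ?thesis
    unfolding isCont_def slope_def by (intro tendsto_diff tendsto_mult tendsto_const 1 2)
qed

text \<open>Since \<open>p / q = p - 1\<close>, both terms of \<open>slope\<close> scale like
  \<open>s powr (p - 1)\<close>. After division they tend to \<open>c\<close> and 1, and
  \<open>c > 1\<close>.\<close>

lemma slope_pos: "\<exists>s. slope s > 0"
proof -
  have "(\<lambda>n. c * (moment (p - 1) (real (Suc n)) / real (Suc n) powr (p - 1)) -
      (moment p (real (Suc n)) / real (Suc n) powr p) powr (1 / q)) \<longlonglongrightarrow> c * 1 - 1 powr (1 / q)"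
    using p by (intro tendsto_intros moment_scaled_tendsto) auto
  then have "\<forall>\<^sub>F n in sequentially. 0 < c * (moment (p - 1) (real (Suc n)) / real (Suc n) powr (p - 1)) -
      (moment p (real (Suc n)) / real (Suc n) powr p) powr (1 / q)"
    by (rule order_tendstoD) (use c in simp)
  then obtain n where "0 < c * (moment (p - 1) (real (Suc n)) / real (Suc n) powr (p - 1)) -
      (moment p (real (Suc n)) / real (Suc n) powr p) powr (1 / q)"
    by (auto simp: eventually_sequentially)
  also have "\<dots> = slope (real (Suc n)) / real (Suc n) powr (p - 1)"
    using powr_conj_exponent[OF p conj]
    by (simp add: slope_def powr_divide powr_powr diff_divide_distrib del: of_nat_Suc)
  finally show ?thesis
    by (auto simp: zero_less_divide_iff simp del: of_nat_Suc)
qed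

text \<open>Tests \<open>S\<close> with the normalised \<open>(p - 1)\<close>-th power of the
  positive part of \<open>s + V\<close>. Nonnegative slope, raised to the power \<open>q\<close>, is
  exactly the \<open>q\<close>-moment constraint for this density.\<close>

lemma moment_ratio_le_S:
  assumes s: "moment (p - 1) s > 0" "slope s \<ge> 0"
  shows "ereal (moment p s / moment (p - 1) s - s) \<le> S"
proof -
  let ?\<psi> = "moment (p - 1) s"
  let ?Z = "\<lambda>t. max (s + V t) 0"
  define g where "g t = ?Z t powr (p - 1) / ?\<psi>" for t
  have int: "integrable unif (\<lambda>t. ?Z t powr (p - 1))" "integrable unif (\<lambda>t. ?Z t powr p)"
    using p by (auto intro!: integrable_moment)
  have gq: "g t powr q = ?Z t powr p / ?\<psi> powr q" for t
    using powr_conj_exponent[OF p conj] by (simp add: g_def powr_divide powr_powr)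
  have "(moment p s powr (1 / q)) powr q \<le> (c * ?\<psi>) powr q"
    using s q by (intro powr_mono2) (auto simp: slope_def)
  then have le: "moment p s / ?\<psi> powr q \<le> c powr q"
    using q s by (simp add: powr_powr moment_nonneg powr_mult divide_le_eq)
  have Vg: "V t * g t = (?Z t powr p - s * ?Z t powr (p - 1)) / ?\<psi>" for t
  proof (cases "s + V t > 0")
    case True
    then have "?Z t powr p = ?Z t * ?Z t powr (p - 1)" by (simp add: powr_mult_base)
    then show ?thesis using True by (simp add: g_def algebra_simps)
  qed (simp add: g_def)
  have "(\<integral>t. V t * g t \<partial>unif) = (moment p s - s * ?\<psi>) / ?\<psi>"
    unfolding Vg using int by (simp add: moment_def)
  also have "\<dots> = moment p s / ?\<psi> - s"
    using s by (simp add: diff_divide_distrib)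
  finally have "(\<integral>t. V t * g t \<partial>unif) = moment p s / ?\<psi> - s" .
  moreover have "ereal (\<integral>t. V t * g t \<partial>unif) \<le> S"
  proof (rule integral_le_SUP_average[OF antimono integrable])
    show "antimono_on {0<..<1} g"
    proof (rule monotone_onI)
      fix x y :: real assume "x \<in> {0<..<1}" "y \<in> {0<..<1}" "x \<le> y"
      then have "?Z y \<le> ?Z x" using V_le[of x y] by auto
      then show "g y \<le> g x"
        unfolding g_def using p s by (intro divide_right_mono powr_mono2) auto
    qed
    show "(\<integral>t. g t \<partial>unif) = 1"
      unfolding g_def using s by (simp add: moment_def)
    show "(\<integral>t. g t powr q \<partial>unif) \<le> c powr q"
      unfolding gq using le by (simp add: moment_def)
    show "integrable unif (\<lambda>t. g t powr q)" "integrable unif (\<lambda>t. V t * g t)"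
      unfolding gq Vg using int by auto
  qed (use int s in \<open>auto simp: g_def\<close>)
  ultimately show ?thesis by simp
qed

lemma T_bar_le_moment: "T_bar unif c p (\<lambda>t. - V t) \<le> ereal (c * moment p s powr (1 / p) - s)"
proof -
  have "T_bar unif c p (\<lambda>t. - V t) \<le> ereal c * lp_norm unif p (\<lambda>t. max (s - - V t) 0) - ereal s"
    unfolding T_bar_def by (rule INF_lower) simp
  also have "\<dots> = ereal (c * moment p s powr (1 / p) - s)"
    using integrable_moment[of p s] p by (simp add: lp_norm_max moment_def)
  finally show ?thesis .
qed

lemma T_bar_le_S: "T_bar unif c p (\<lambda>t. - V t) \<le> S"
proof -
  obtain s1 where s1: "slope s1 > 0" using slope_pos by blast
  have "0 < c * moment (p - 1) s1"
    using s1 powr_ge_zero[of "moment p s1" "1 / q"] unfolding slope_def by linarith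
  then have \<psi>1: "moment (p - 1) s1 > 0"
    using c by (simp add: zero_less_mult_iff)
  show ?thesis
  \<comment> \<open>The positivity of the moment excludes shifts at which \<open>s + V\<close> has
    no positive part, where the slope is trivially 0.\<close>
  proof (cases "\<exists>s0\<le>s1. moment (p - 1) s0 > 0 \<and> slope s0 \<le> 0")
    case True
    then obtain s0 where s0: "s0 \<le> s1" "moment (p - 1) s0 > 0" "slope s0 \<le> 0" by blast
    \<comment> \<open>At a zero of the slope the objective of \<open>T_bar\<close> equals the moment
      ratio attained by the test density.\<close>
    obtain s where s: "s0 \<le> s" "slope s = 0"
      using IVT[of slope s0 0 s1] s0 s1 isCont_slope by auto
    have \<psi>: "moment (p - 1) s > 0"
      using moment_mono[OF s(1), of "p - 1"] s0(2) p by auto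
    define \<phi> where "\<phi> = moment p s"
    have \<psi>_eq: "c * moment (p - 1) s = \<phi> powr (1 / q)"
      using s(2) by (simp add: slope_def \<phi>_def)
    have \<phi>: "\<phi> > 0"
      using \<psi> \<psi>_eq c moment_nonneg[of p s] by (cases "\<phi> = 0") (auto simp: \<phi>_def)
    have "c * \<phi> powr (1 / p) = c * \<phi> powr (1 - 1 / q)"
      by (simp add: powr_conj_exponent[OF p conj])
    also have "\<dots> = c * \<phi> / \<phi> powr (1 / q)"
      using \<phi> by (simp add: powr_diff)
    also have "\<dots> = \<phi> / moment (p - 1) s"
      using c by (simp flip: \<psi>_eq)
    finally have "T_bar unif c p (\<lambda>t. - V t) \<le> ereal (moment p s / moment (p - 1) s - s)"
      using T_bar_le_moment[of s] by (simp add: \<phi>_def)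
    also have "\<dots> \<le> S"
      by (rule moment_ratio_le_S) (use s \<psi> in auto)
    finally show ?thesis .
  next
    case False
    \<comment> \<open>Without such an \<open>s0\<close> the slope is positive at all these
      \<open>s\<close>, so the test density is admissible.\<close>
    have S_ge: "ereal (- s) \<le> S" if "s \<le> s1" "moment (p - 1) s > 0" for s
    proof -
      have "ereal (- s) \<le> ereal (moment p s / moment (p - 1) s - s)"
        using that moment_nonneg[of p s] by simp
      also have "\<dots> \<le> S"
        using False that by (intro moment_ratio_le_S) auto
      finally show ?thesis .
    qed
    show ?thesis
    proof (cases S)
      case (real \<sigma>)
      \<comment> \<open>At \<open>s = - \<sigma> - e\<close> a positive moment would give
        \<open>\<sigma> + e \<le> S\<close>. So \<open>s + V\<close> has no positive part almost
        everywhere, and the objective there is just \<open>- s\<close>.\<close>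
      have T_le: "T_bar unif c p (\<lambda>t. - V t) \<le> ereal (\<sigma> + e)" if "e > 0" for e
      proof -
        have "s1 \<ge> - \<sigma>" using S_ge[OF order_refl \<psi>1] real by simp
        then have "\<not> moment (p - 1) (- \<sigma> - e) > 0"
          using S_ge[of "- \<sigma> - e"] real that by auto
        then have "moment (p - 1) (- \<sigma> - e) = 0"
          using moment_nonneg[of "p - 1" "- \<sigma> - e"] by linarith
        then have "AE t in unif. max (- \<sigma> - e + V t) 0 powr (p - 1) = 0"
          unfolding moment_def using p integrable_moment[of "p - 1" "- \<sigma> - e"]
          by (subst (asm) integral_nonneg_eq_0_iff_AE) auto
        then have "AE t in unif. max (- \<sigma> - e + V t) 0 powr p = 0"
          by eventually_elim auto
        then have "moment p (- \<sigma> - e) = 0"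
          unfolding moment_def by (rule integral_eq_zero_AE)
        then show ?thesis
          using T_bar_le_moment[of "- \<sigma> - e"] by (simp add: add.commute)
      qed
      show ?thesis
        unfolding real by (rule ereal_le_epsilon2) (use T_le in simp)
    next
      case MInf
      then show ?thesis using S_ge[OF order_refl \<psi>1] by simp
    qed simp
  qed
qed

end

lemma T_bar_eq_S: "T_bar unif c p (\<lambda>t. - V t) = S"
proof (rule antisym)
  show "T_bar unif c p (\<lambda>t. - V t) \<le> S"
    \<comment> \<open>Without \<open>p\<close>-integrability of the positive part the supremum is
      already infinite.\<close>
    using T_bar_le_S S_eq_infinity by (cases "integrable unif (\<lambda>t. max (V t) 0 powr p)") auto
  show "S \<le> T_bar unif c p (\<lambda>t. - V t)"
    unfolding T_bar_def
  proof (intro SUP_least INF_greatest)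
    fix \<mu> s assume "\<mu> \<in> M_set c q"
    then show "ext_integral \<mu> (average V) \<le> ereal c * lp_norm unif p (\<lambda>t. max (s - - V t) 0) - ereal s"
      using ext_integral_average_le[OF _ p conj _ antimono integrable, of \<mu> c s] c by simp
  qed
qed

end

theorem corollary14:
  fixes M :: "'a measure" and p c q :: real and X :: "'a \<Rightarrow> real"
  assumes "prob_space M" and "nonatomic M"
    and "p > 1" and "c > 1"
    and "1 / q + 1 / p = 1"
    and "integrable M X"
  shows "T_bar M c p X = (SUP \<mu>\<in>M_set c q. ext_integral \<mu> (\<lambda>\<alpha>. AVaR M \<alpha> X))"
proof -
  \<comment> \<open>The identity on the unit interval is used for the value at risk, whose averages
    are by definition the \<open>AVaR\<close>.\<close>
  interpret quantile_loss "\<lambda>t. VaR M t X" p q c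
    using assms antimono_VaR[of M X] integrable_VaR[of M X] by unfold_locales auto
  show ?thesis
    using T_bar_VaR[OF assms(1,6)] T_bar_eq_S by (simp add: AVaR_def)
qed

end
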